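(* Let $A\in\mathbb{C}^{n\times n}$ be non-nilpotent with $\mathrm{ind}(A)=k\ge 1$. Let $A=B_1G_1$ be a full-rank decomposition, and for $i=1,2,\dots,k-1$ let $G_iB_i=B_{i+1}G_{i+1}$ also be full-rank decompositions. Put $B=B_1B_2\cdots B_k$ and $G=G_k\cdots G_2G_1$. Then $$A^{\text{cEP}}=\lim_{\lambda\to 0}B(BG_kB_k)^{*}\bigl(BG_kB_k(BG_kB_k)^{*}+\lambda I\bigr)^{-1}=\lim_{\lambda\to 0}B\bigl((BG_kB_k)^{*}BG_kB_k+\lambda I\bigr)^{-1}(BG_kB_k)^{*}$$ and $$A_{\text{cEP}}=\lim_{\lambda\to 0}\bigl((G_kB_kG)^{*}G_kB_kG+\lambda I\bigr)^{-1}(G_kB_kG)^{*}G=\lim_{\lambda\to 0}(G_kB_kG)^{*}\bigl(G_kB_kG(G_kB_kG)^{*}+\lambda I\bigr)^{-1}G,$$ where $A^{\text{cEP}}$ is the core-EP inverse of $A$ and $A_{\text{cEP}}$ is the dual core-EP inverse of $A$.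
   Context: $M^*$ is the conjugate transpose, $\mathrm{rk}(M)$ the rank, $R(M)$ the range (column space) of a complex matrix $M$, and $I$ is an identity matrix of appropriate order. The index $\mathrm{ind}(A)$ of a square matrix $A$ is the smallest nonnegative integer $k$ with $\mathrm{rk}(A^k)=\mathrm{rk}(A^{k+1})$. A full-rank decomposition of a matrix $M\in\mathbb{C}^{p\times q}$ of rank $r$ is a factorization $M=FH$ with $F\in\mathbb{C}^{p\times r}$, $H\in\mathbb{C}^{r\times q}$, both of rank $r$. The Drazin inverse $A^D$ of $A\in\mathbb{C}^{n\times n}$ with $k=\mathrm{ind}(A)$ is the unique matrix with $A^{k+1}A^D=A^k$, $A^DAA^D=A^D$, $AA^D=A^DA$. The core-EP inverse $A^{\text{cEP}}$ is the unique matrix $X\in\mathbb{C}^{n\times n}$ with $XAX=X$ and $R(X)=R(X^* )=R(A^D)$. The dual core-EP inverse $A_{\text{cEP}}$ is the unique matrix $X\in\mathbb{C}^{n\times n}$ with $XAX=X$ and $R(X)=R(X^* )=R((A^* )^D)$. Limits are taken as $\lambda\to0$ through nonzero complex scalars; for all sufficiently small $\lambda\ne 0$ the indicated inverses exist. *)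

theory Defs
  imports
    Complex_Main
    "Jordan_Normal_Form.Schur_Decomposition"
    "Jordan_Normal_Form.DL_Rank"
begin

abbreviation rk :: "complex mat \<Rightarrow> nat" where
  "rk M \<equiv> vec_space.rank (dim_row M) M"

abbreviation range_mat :: "complex mat \<Rightarrow> complex vec set" where
  "range_mat M \<equiv> vec_space.col_space (dim_row M) M"

(* unspecified when M is singular *)
abbreviation mat_inv :: "complex mat \<Rightarrow> complex mat" where
  "mat_inv M \<equiv> the (mat_inverse M)"

definition nilpotent_mat :: "complex mat \<Rightarrow> bool" where
  "nilpotent_mat A \<longleftrightarrow> (\<exists>m. A ^\<^sub>m m = 0\<^sub>m (dim_row A) (dim_row A))"

definition matrix_index :: "complex mat \<Rightarrow> nat" where
  "matrix_index A = (LEAST k. rk (A ^\<^sub>m k) = rk (A ^\<^sub>m (Suc k)))"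

definition full_rank_decomposition :: "complex mat \<Rightarrow> complex mat \<Rightarrow> complex mat \<Rightarrow> bool" where
  "full_rank_decomposition M F H \<longleftrightarrow>
     F \<in> carrier_mat (dim_row M) (rk M) \<and> H \<in> carrier_mat (rk M) (dim_col M) \<and>
     rk F = rk M \<and> rk H = rk M \<and> M = F * H"

definition is_drazin_inverse :: "complex mat \<Rightarrow> complex mat \<Rightarrow> bool" where
  "is_drazin_inverse A X \<longleftrightarrow>
     X \<in> carrier_mat (dim_row A) (dim_row A) \<and>
     A ^\<^sub>m (Suc (matrix_index A)) * X = A ^\<^sub>m (matrix_index A) \<and>
     X * A * X = X \<and>
     A * X = X * A"

definition drazin_inverse :: "complex mat \<Rightarrow> complex mat" where
  "drazin_inverse A = (THE X. is_drazin_inverse A X)"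

definition is_core_EP_inverse :: "complex mat \<Rightarrow> complex mat \<Rightarrow> bool" where
  "is_core_EP_inverse A X \<longleftrightarrow>
     X \<in> carrier_mat (dim_row A) (dim_row A) \<and>
     X * A * X = X \<and>
     range_mat X = range_mat (mat_adjoint X) \<and>
     range_mat (mat_adjoint X) = range_mat (drazin_inverse A)"

definition core_EP_inverse :: "complex mat \<Rightarrow> complex mat" where
  "core_EP_inverse A = (THE X. is_core_EP_inverse A X)"

definition is_dual_core_EP_inverse :: "complex mat \<Rightarrow> complex mat \<Rightarrow> bool" where
  "is_dual_core_EP_inverse A X \<longleftrightarrow>
     X \<in> carrier_mat (dim_row A) (dim_row A) \<and>
     X * A * X = X \<and>
     range_mat X = range_mat (mat_adjoint X) \<and>
     range_mat (mat_adjoint X) = range_mat (drazin_inverse (mat_adjoint A))"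

definition dual_core_EP_inverse :: "complex mat \<Rightarrow> complex mat" where
  "dual_core_EP_inverse A = (THE X. is_dual_core_EP_inverse A X)"

(* prod_up n B k = B 1 * B 2 * ... * B k  and  prod_down n G k = G k * ... * G 2 * G 1;
   the entry at 0 is not used, and n is the order of the identity matrix for the empty product. *)

primrec prod_up :: "nat \<Rightarrow> (nat \<Rightarrow> complex mat) \<Rightarrow> nat \<Rightarrow> complex mat" where
  "prod_up n B 0 = 1\<^sub>m n"
| "prod_up n B (Suc i) = prod_up n B i * B (Suc i)"

primrec prod_down :: "nat \<Rightarrow> (nat \<Rightarrow> complex mat) \<Rightarrow> nat \<Rightarrow> complex mat" where
  "prod_down n G 0 = 1\<^sub>m n"
| "prod_down n G (Suc i) = G (Suc i) * prod_down n G i"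

(* The type of matrices of all sizes carries no topology; convergence is entrywise,
   between matrices that eventually have the size of the limit. *)
definition mat_tendsto :: "('b \<Rightarrow> complex mat) \<Rightarrow> complex mat \<Rightarrow> 'b filter \<Rightarrow> bool" where
  "mat_tendsto f L F \<longleftrightarrow>
     (\<forall>\<^sub>F x in F. f x \<in> carrier_mat (dim_row L) (dim_col L)) \<and>
     (\<forall>i<dim_row L. \<forall>j<dim_col L. ((\<lambda>x. f x $$ (i, j)) \<longlongrightarrow> L $$ (i, j)) F)"

end

theory Submission
  imports Defs
begin

text \<open>
  Telescoping the decompositions gives \<open>A\<^sup>k = B G\<close> with \<open>A B = B M\<close> and \<open>G A = M G\<close>, where
  \<open>M = G\<^sub>k B\<^sub>k\<close>, \<open>B\<close> has a left inverse and \<open>G\<close> a right inverse; \<open>k\<close> being the index makes \<open>M\<close>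
  invertible. Hence \<open>A\<^sup>D = B M\<^bsup>-k-1\<^esup> G\<close> has the range of \<open>B\<close>, and with \<open>P = B M = A B\<close> the matrix
  \<open>B (P\<^sup>* P)\<^bsup>-1\<^esup> P\<^sup>*\<close> satisfies the equations of the core-EP inverse. An outer inverse is determined by
  its range and the range of its adjoint, so this is the core-EP inverse. The limits follow from
  continuity of inversion at the invertible matrix \<open>P\<^sup>* P\<close> and from
  \<open>P\<^sup>* (P P\<^sup>* + t I)\<^bsup>-1\<^esup> = (P\<^sup>* P + t I)\<^bsup>-1\<^esup> P\<^sup>*\<close>. The situation is symmetric under
  \<open>(A, B, G, M) \<mapsto> (A\<^sup>*, G\<^sup>*, B\<^sup>*, M\<^sup>*)\<close>, which yields the dual statement.
\<close>

section \<open>Products and adjoints\<close>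

text \<open>The side conditions are equations between dimensions, not carrier memberships, so that
  \<open>simp\<close> can discharge them while it reassociates products to the right.\<close>

lemma mult_mat_assoc_dim:
  "dim_col A = dim_row B \<Longrightarrow> dim_col B = dim_row C \<Longrightarrow> A * B * C = A * (B * (C :: 'a :: semiring_0 mat))"
  by (rule assoc_mult_mat) auto

lemma one_mult_mat_dim: "dim_row A = n \<Longrightarrow> 1\<^sub>m n * A = (A :: 'a :: semiring_1 mat)"
  by (rule left_mult_one_mat) auto

lemma mult_one_mat_dim: "dim_col A = n \<Longrightarrow> A * 1\<^sub>m n = (A :: 'a :: semiring_1 mat)"
  by (rule right_mult_one_mat) auto

lemmas mat_dim_simps = mult_mat_assoc_dim one_mult_mat_dim mult_one_mat_dim

text \<open>In a right-nested product a known \<open>A * B = C\<close> no longer occurs as a subterm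
  once a further factor follows; this form carries the tail \<open>W\<close> along.\<close>

lemma mult_mat_rewrite_prefix:
  "A * B = C \<Longrightarrow> dim_col A = dim_row B \<Longrightarrow> dim_col B = dim_row W \<Longrightarrow> A * (B * W) = C * (W :: 'a :: semiring_0 mat)"
  by (metis mult_mat_assoc_dim)

lemma mult_mat_zero_vec:
  "M \<in> carrier_mat a b \<Longrightarrow> M *\<^sub>v 0\<^sub>v b = (0\<^sub>v a :: 'a :: semiring_0 vec)"
  by (auto intro!: eq_vecI)

lemma dim_mat_adjoint [simp]:
  "dim_row (mat_adjoint A) = dim_col A" "dim_col (mat_adjoint A) = dim_row A"
  by (auto simp: mat_adjoint_def)

lemma mat_adjoint_carrier [simp]:
  "A \<in> carrier_mat n m \<Longrightarrow> mat_adjoint A \<in> carrier_mat m n"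
  by auto

lemma index_mat_adjoint [simp]:
  "i < dim_col A \<Longrightarrow> j < dim_row A \<Longrightarrow> mat_adjoint A $$ (i, j) = conjugate (A $$ (j, i))"
  by (simp add: mat_adjoint_def mat_of_rows_index)

lemma mat_adjoint_adjoint [simp]: "mat_adjoint (mat_adjoint A) = (A :: 'a :: conjugatable_field mat)"
  by (rule eq_matI) auto

lemma mat_adjoint_one [simp]: "mat_adjoint (1\<^sub>m n :: complex mat) = 1\<^sub>m n"
  by (rule eq_matI) auto

lemma mat_adjoint_mult:
  fixes A B :: "'a :: conjugatable_field mat"
  assumes "dim_col A = dim_row B"
  shows "mat_adjoint (A * B) = mat_adjoint B * mat_adjoint A"
proof (rule eq_matI)
  fix i j assume "i < dim_row (mat_adjoint B * mat_adjoint A)" "j < dim_col (mat_adjoint B * mat_adjoint A)"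
  then show "mat_adjoint (A * B) $$ (i, j) = (mat_adjoint B * mat_adjoint A) $$ (i, j)"
    using assms by (simp add: scalar_prod_def sum_conjugate conjugate_dist_mul mult.commute)
qed auto

lemma mat_adjoint_pow:
  fixes A :: "complex mat"
  assumes A: "A \<in> carrier_mat n n"
  shows "mat_adjoint (A ^\<^sub>m k) = mat_adjoint A ^\<^sub>m k"
proof (induction k)
  case (Suc k)
  have "mat_adjoint A ^\<^sub>m k * mat_adjoint A = mat_adjoint A * mat_adjoint A ^\<^sub>m k" for k
    using A by (induction k) (auto simp: mat_dim_simps)
  then show ?case
    using A Suc by (simp add: mat_adjoint_mult)
qed (use A in simp)

section \<open>Range and rank\<close>

lemma range_mat_eq: "range_mat M = {M *\<^sub>v x | x. x \<in> carrier_vec (dim_col M)}"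
  using vec_space.col_space_eq[of M "dim_row M" "dim_col M"] by (auto intro: mult_mat_vec_carrier)

lemma range_mat_mult_subset:
  assumes "dim_col Y = dim_row U"
  shows "range_mat (Y * U) \<subseteq> range_mat Y"
proof -
  have "(Y * U) *\<^sub>v x = Y *\<^sub>v (U *\<^sub>v x)" if "x \<in> carrier_vec (dim_col U)" for x
    using that assms by (intro assoc_mult_mat_vec) auto
  then show ?thesis
    using assms unfolding range_mat_eq by (fastforce intro: mult_mat_vec_carrier)
qed

text \<open>Each column of \<open>X\<close> is the image of a unit vector, hence has a preimage
  under \<open>Y\<close>; these preimages are the columns of \<open>U\<close>.\<close>

lemma range_mat_subset_imp_factor:
  assumes X: "X \<in> carrier_mat n m" and Y: "Y \<in> carrier_mat n l"
    and sub: "range_mat X \<subseteq> range_mat Y"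
  obtains U where "U \<in> carrier_mat l m" "X = Y * U"
proof -
  have "\<exists>u. u \<in> carrier_vec (dim_col Y) \<and> col X j = Y *\<^sub>v u" if "j < dim_col X" for j
  proof -
    have "col X j = X *\<^sub>v unit_vec (dim_col X) j"
      using that by (intro eq_vecI) auto
    then have "col X j \<in> range_mat X"
      by (auto simp: range_mat_eq)
    then show ?thesis using sub unfolding range_mat_eq by blast
  qed
  then obtain u where u: "\<And>j. j < dim_col X \<Longrightarrow> u j \<in> carrier_vec (dim_col Y) \<and> col X j = Y *\<^sub>v u j"
    by metis
  define U where "U = mat (dim_col Y) (dim_col X) (\<lambda>(i, j). u j $ i)"
  have U: "U \<in> carrier_mat (dim_col Y) (dim_col X)" by (simp add: U_def)
  have colU: "col U j = u j" if "j < dim_col X" for j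
    using that u[OF that] by (intro eq_vecI) (auto simp: U_def)
  have "X = Y * U"
  proof (rule mat_col_eqI)
    fix j assume "j < dim_col (Y * U)"
    then have j: "j < dim_col X" using U by simp
    show "col X j = col (Y * U) j"
      using j u[OF j] colU[OF j] U col_mult2[of Y "dim_row Y" "dim_col Y" U "dim_col X" j] by simp
  qed (use U X Y in auto)
  moreover have "U \<in> carrier_mat l m" using U X Y by simp
  ultimately show ?thesis using that by blast
qed

section \<open>Rank as the dimension of the column space\<close>

lemma (in vec_space) rank_basis_of_columns:
  assumes X: "X \<in> carrier_mat n m"
  obtains S where "S \<subseteq> set (cols X)" "lin_indpt S" "card S = rank X" "span S = col_space X"
proof -
  obtain S where S: "maximal S (\<lambda>T. T \<subseteq> set (cols X) \<and> lin_indpt T)"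
    using maximal_exists_superset[of "set (cols X)" "(\<lambda>T. T \<subseteq> set (cols X) \<and> lin_indpt T)" "{}"]
    by (metis List.finite_set empty_subsetI finite_lin_indpt2 equals0D finite.emptyI)
  have li: "lin_indpt S" and sub: "S \<subseteq> set (cols X)" using S by (auto simp: maximal_def)
  have cX: "set (cols X) \<subseteq> carrier_vec n" using cols_dim[of X] carrier_matD(1)[OF X] by simp
  then have cS: "S \<subseteq> carrier_vec n" using sub by blast
  \<comment> \<open>A column outside the span could be adjoined to \<open>S\<close> without losing
    independence, against maximality.\<close>
  have "set (cols X) \<subseteq> span S"
  proof
    fix s assume s: "s \<in> set (cols X)"
    show "s \<in> span S"
    proof (rule ccontr)
      assume n: "s \<notin> span S"
      then have sS: "s \<notin> S" using in_own_span cS by (auto dest: subsetD)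
      have "s \<in> carrier_vec n" using s cX by blast
      then have "lin_indpt (S \<union> {s})"
        using lin_dep_iff_in_span[of S s] cS li sS n by simp
      moreover have "S \<union> {s} \<subseteq> set (cols X)" using s sub by blast
      ultimately have "S \<union> {s} = S" using S unfolding maximal_def by blast
      then show False using sS by blast
    qed
  qed
  then have "span (set (cols X)) \<subseteq> span S"
    by (rule span_is_subset) (use span_is_submodule cS in simp)
  moreover have "span S \<subseteq> span (set (cols X))" using sub by (rule span_is_monotone)
  ultimately have "span S = col_space X" by (auto simp: col_space_def)
  moreover have "card S = rank X" using rank_card_indpt[OF X S] by simp
  ultimately show ?thesis using li sub that by blast
qed

text \<open>A basis of the smaller space is an independent set in the larger one whose size is
  already the dimension, so it spans the larger one too.\<close>

lemma (in vec_space) col_space_eq_if_rank_eq: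
  assumes X: "X \<in> carrier_mat n m" and Y: "Y \<in> carrier_mat n l"
    and sub: "col_space X \<subseteq> col_space Y" and r: "rank X = rank Y"
  shows "col_space X = col_space Y"
proof -
  obtain S where S: "S \<subseteq> set (cols X)" "lin_indpt S" "card S = rank X" "span S = col_space X"
    using rank_basis_of_columns[OF X] .
  define W where "W = col_space Y"
  have cY: "set (cols Y) \<subseteq> carrier V" using cols_dim[of Y] carrier_matD(1)[OF Y] by simp
  have cS: "S \<subseteq> carrier V" using S(1) cols_dim[of X] carrier_matD(1)[OF X] by auto
  have subW: "submodule class_ring W V" and spW: "VectorSpace.subspace class_ring W V"
    unfolding W_def col_space_def using span_is_submodule span_is_subspace cY by auto
  have vsW: "vectorspace class_ring (vs W)" using spW subspace_is_vs by blast
  have SW: "S \<subseteq> W" using S(4) sub in_own_span[of S] cS by (auto simp: W_def)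
  \<comment> \<open>The dimension argument takes place inside the subspace \<open>W\<close>, so
    independence is carried into it and the span is carried back.\<close>
  have "LinearCombinations.module.lin_indpt class_ring (vs W) S"
    using span_li_not_depend(2)[OF SW subW] S(2) by simp
  moreover have "vectorspace.fin_dim class_ring (vs W)"
    unfolding W_def col_space_def using fin_dim_span_cols[OF Y] .
  moreover have "vectorspace.dim class_ring (vs W) = card S"
    using r S(3) by (simp add: W_def col_space_def rank_def)
  moreover have "finite S" using S(1) finite_subset by blast
  ultimately have "vectorspace.basis class_ring (vs W) S"
    using vectorspace.dim_li_is_basis[OF vsW] SW by simp
  then have "LinearCombinations.module.span class_ring (vs W) S = W"
    using vectorspace.basis_def[OF vsW] by simp
  then have "span S = W" using span_li_not_depend(1)[OF SW subW] by simp
  then show ?thesis using S(4) W_def by simp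
qed

lemma (in vec_space) rank_mono:
  assumes X: "X \<in> carrier_mat n m" and Y: "Y \<in> carrier_mat n l"
    and sub: "col_space X \<subseteq> col_space Y"
  shows "rank X \<le> rank Y"
proof -
  have cY: "set (cols Y) \<subseteq> carrier V" and cX: "set (cols X) \<subseteq> carrier V"
    using cols_dim[of X] cols_dim[of Y] carrier_matD(1)[OF X] carrier_matD(1)[OF Y] by auto
  have spX: "VectorSpace.subspace class_ring (col_space X) V" and spY: "VectorSpace.subspace class_ring (col_space Y) V"
    using span_is_subspace cX cY by (auto simp: col_space_def)
  have "vectorspace class_ring (vs (col_space Y))" using spY subspace_is_vs by blast
  from vectorspace.subspace_dim[OF this nested_subspaces[OF spY spX sub]]
  show ?thesis using fin_dim_span_cols X Y by (simp add: col_space_def rank_def)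
qed

text \<open>A nonzero kernel vector would be a dependency between the columns. Independence concerns
  the set of columns, so it is first shown that no column is repeated: \<open>r\<close> independent
  ones occur among only \<open>r\<close> positions.\<close>

lemma (in vec_space) full_rank_mult_vec_eq_zero:
  assumes F: "F \<in> carrier_mat n r" "rank F = r"
    and v: "v \<in> carrier_vec r" "F *\<^sub>v v = 0\<^sub>v n"
  shows "v = 0\<^sub>v r"
proof -
  obtain S where S: "S \<subseteq> set (cols F)" "lin_indpt S" "card S = rank F" "span S = col_space F"
    using rank_basis_of_columns[OF F(1)] .
  have "length (cols F) \<le> card (set (cols F))"
    using S card_mono[OF _ S(1)] F by simp
  then have dis: "distinct (cols F)"
    by (metis card_distinct card_length le_antisym)
  then have "lin_indpt (set (cols F))"
    using full_rank_lin_indpt F by blast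
  then show ?thesis using lin_depI[OF F(1) v(1) _ v(2) dis] by blast
qed

section \<open>Gram matrices and one-sided inverses\<close>

lemma det_nonzero_obtain_inverse:
  fixes C :: "'a :: field mat"
  assumes C: "C \<in> carrier_mat n n" and "det C \<noteq> 0"
  obtains D where "D \<in> carrier_mat n n" "C * D = 1\<^sub>m n" "D * C = 1\<^sub>m n"
  using det_non_zero_imp_unit[OF assms, unfolded Units_def, of "()"]
  by (auto simp: ring_mat_simps)

text \<open>If \<open>F^* F v = 0\<close>, then \<open>w = F v\<close> satisfies
  \<open>w \<bullet>c w = 0\<close>, so \<open>F v = 0\<close> and injectivity gives
  \<open>v = 0\<close>.\<close>

lemma det_adjoint_mult_self_nonzero:
  fixes F :: "complex mat"
  assumes F: "F \<in> carrier_mat n r"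
    and inj: "\<And>v. v \<in> carrier_vec r \<Longrightarrow> F *\<^sub>v v = 0\<^sub>v n \<Longrightarrow> v = 0\<^sub>v r"
  shows "det (mat_adjoint F * F) \<noteq> 0"
proof
  assume "det (mat_adjoint F * F) = 0"
  then obtain v where v: "v \<in> carrier_vec r" "v \<noteq> 0\<^sub>v r" "(mat_adjoint F * F) *\<^sub>v v = 0\<^sub>v r"
    using F det_0_iff_vec_prod_zero_field[of "mat_adjoint F * F" r]
    by (metis mat_adjoint_carrier mult_carrier_mat)
  define w where "w = F *\<^sub>v v"
  have w: "w \<in> carrier_vec n" using F v by (simp add: w_def)
  have z: "mat_adjoint F *\<^sub>v w = 0\<^sub>v r"
    using v F assoc_mult_mat_vec[of "mat_adjoint F" r n F r v] by (simp add: w_def)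
  have colw: "(\<Sum>i<n. F $$ (i, j) * conjugate (w $ i)) = 0" if j: "j < r" for j
  proof -
    have "(\<Sum>i<n. F $$ (i, j) * conjugate (w $ i)) = conjugate ((mat_adjoint F *\<^sub>v w) $ j)"
      using j F w by (simp add: scalar_prod_def lessThan_atLeast0 sum_conjugate)
    then show ?thesis using z j by simp
  qed
  have wi: "w $ i = (\<Sum>j<r. F $$ (i, j) * v $ j)" if "i < n" for i
    using that F v by (simp add: w_def scalar_prod_def lessThan_atLeast0)
  \<comment> \<open>Expanding the first factor as \<open>F v\<close> and exchanging the sums leaves
    the conjugated entries of \<open>F^* w\<close>, which vanish.\<close>
  have "w \<bullet>c w = (\<Sum>i<n. w $ i * conjugate (w $ i))"
    using w by (simp add: scalar_prod_def lessThan_atLeast0)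
  also have "\<dots> = (\<Sum>i<n. \<Sum>j<r. v $ j * (F $$ (i, j) * conjugate (w $ i)))"
    by (intro sum.cong refl) (simp add: wi sum_distrib_right mult_ac)
  also have "\<dots> = (\<Sum>j<r. v $ j * (\<Sum>i<n. F $$ (i, j) * conjugate (w $ i)))"
    by (subst sum.swap) (simp add: sum_distrib_left)
  also have "\<dots> = 0" using colw by simp
  finally have "w = 0\<^sub>v n" using w by simp
  then show False using inj v w_def by simp
qed

text \<open>The left inverse is \<open>(F^* F)^-1 F^*\<close>.\<close>

lemma full_col_rank_left_inverse:
  assumes F: "F \<in> carrier_mat n r" and rk: "rk F = r"
  obtains L where "L \<in> carrier_mat r n" "L * F = 1\<^sub>m r"
proof -
  have "vec_space.rank n F = r" using F rk by simp
  note inj = vec_space.full_rank_mult_vec_eq_zero[OF F this]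
  have C: "mat_adjoint F * F \<in> carrier_mat r r" using F by auto
  obtain D where D: "D \<in> carrier_mat r r" "D * (mat_adjoint F * F) = 1\<^sub>m r"
    using det_nonzero_obtain_inverse[OF C det_adjoint_mult_self_nonzero[OF F inj]] .
  show ?thesis
    using F D by (intro that[of "D * mat_adjoint F"]) (auto simp: mat_dim_simps)
qed

text \<open>The range of \<open>H\<close> has full dimension, so it equals the range of the
  identity; factoring the identity through \<open>H\<close> yields \<open>R\<close>.\<close>

lemma full_row_rank_right_inverse:
  assumes H: "H \<in> carrier_mat r m" and rk: "rk H = r"
  obtains R where "R \<in> carrier_mat m r" "H * R = 1\<^sub>m r"
proof -
  have sub: "range_mat H \<subseteq> range_mat (1\<^sub>m r)"
    using range_mat_mult_subset[of "1\<^sub>m r" H] H by (simp add: mat_dim_simps)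
  have "vec_space.rank r (1\<^sub>m r :: complex mat) = r"
    by (rule vec_space.low_rank_det_zero) auto
  then have "range_mat (1\<^sub>m r) = range_mat H"
    using vec_space.col_space_eq_if_rank_eq[OF H one_carrier_mat] sub rk H by simp
  then have "range_mat (1\<^sub>m r) \<subseteq> range_mat H" by simp
  from range_mat_subset_imp_factor[OF one_carrier_mat H this]
  obtain R where "R \<in> carrier_mat m r" "1\<^sub>m r = H * R" .
  then show ?thesis using that by metis
qed

section \<open>Index and Drazin inverse\<close>

lemma pow_mat_Suc_left:
  fixes A :: "'a :: semiring_1 mat"
  assumes "A \<in> carrier_mat n n"
  shows "A ^\<^sub>m Suc k = A * A ^\<^sub>m k"
  using assms by (induction k) (auto simp: mat_dim_simps)

lemma pow_mat_commute:
  fixes A X :: "'a :: semiring_1 mat"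
  assumes "A \<in> carrier_mat n n" "X \<in> carrier_mat n n" "A * X = X * A"
  shows "A ^\<^sub>m k * X = X * A ^\<^sub>m k"
proof (induction k)
  case (Suc k)
  have "A ^\<^sub>m Suc k * X = A ^\<^sub>m k * (X * A)"
    using assms by (simp add: mat_dim_simps)
  also have "\<dots> = (A ^\<^sub>m k * X) * A"
    using assms by (simp add: mat_dim_simps)
  finally show ?case using assms Suc by (simp add: mat_dim_simps)
qed (use assms in \<open>auto simp: mat_dim_simps\<close>)

lemma range_pow_mat_Suc_subset:
  assumes "A \<in> carrier_mat n n"
  shows "range_mat (A ^\<^sub>m Suc k) \<subseteq> range_mat (A ^\<^sub>m k)"
  using range_mat_mult_subset[of "A ^\<^sub>m k" A] assms by simp

text \<open>The \<open>LEAST\<close> in the definition of the index is meaningful only if the ranks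
  of the powers stabilise somewhere. They never increase, and natural numbers cannot decrease
  strictly forever.\<close>

lemma rk_pow_matrix_index:
  assumes A: "A \<in> carrier_mat n n"
  shows "rk (A ^\<^sub>m matrix_index A) = rk (A ^\<^sub>m Suc (matrix_index A))"
proof -
  have "\<exists>k. rk (A ^\<^sub>m k) = rk (A ^\<^sub>m Suc k)"
  proof (rule ccontr)
    assume neq: "\<not> ?thesis"
    have mono: "rk (A ^\<^sub>m Suc k) \<le> rk (A ^\<^sub>m k)" for k
      using vec_space.rank_mono[of "A ^\<^sub>m Suc k" n n "A ^\<^sub>m k" n] range_pow_mat_Suc_subset[OF A, of k] A
      by simp
    have "rk (A ^\<^sub>m k) + k \<le> rk (A ^\<^sub>m 0)" for k
    proof (induction k)
      case (Suc k)
      have "rk (A ^\<^sub>m Suc k) < rk (A ^\<^sub>m k)" using neq mono[of k] le_neq_implies_less by metis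
      with Suc show ?case by linarith
    qed simp
    from this[of "Suc (rk (A ^\<^sub>m 0))"] show False by linarith
  qed
  then show ?thesis unfolding matrix_index_def by (rule LeastI_ex)
qed

text \<open>At the index the nested ranges of two consecutive powers have equal rank, hence
  coincide.\<close>

lemma pow_matrix_index_factor:
  assumes A: "A \<in> carrier_mat n n"
  obtains U where "U \<in> carrier_mat n n" "A ^\<^sub>m matrix_index A = A ^\<^sub>m Suc (matrix_index A) * U"
proof -
  let ?m = "matrix_index A"
  have "range_mat (A ^\<^sub>m Suc ?m) = range_mat (A ^\<^sub>m ?m)"
    using vec_space.col_space_eq_if_rank_eq[of "A ^\<^sub>m Suc ?m" n n "A ^\<^sub>m ?m" n]
      range_pow_mat_Suc_subset[OF A, of ?m] rk_pow_matrix_index[OF A] A by simp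
  then have "range_mat (A ^\<^sub>m ?m) \<subseteq> range_mat (A ^\<^sub>m Suc ?m)" by simp
  from range_mat_subset_imp_factor[OF _ _ this, of n n n] obtain U
    where "U \<in> carrier_mat n n" "A ^\<^sub>m ?m = A ^\<^sub>m Suc ?m * U"
    using pow_carrier_mat[OF A] by metis
  then show ?thesis by (rule that)
qed

text \<open>The exponent \<open>j\<close> is arbitrary, so the index of the adjoint of \<open>A\<close> never has to be computed.\<close>

lemma is_drazin_inverseI:
  assumes A: "A \<in> carrier_mat n n" and X: "X \<in> carrier_mat n n"
    and outer: "X * A * X = X" and comm: "A * X = X * A" and pow: "A ^\<^sub>m Suc j * X = A ^\<^sub>m j"
  shows "is_drazin_inverse A X"
proof -
  let ?m = "matrix_index A"
  obtain U where U: "U \<in> carrier_mat n n" "A ^\<^sub>m ?m = A ^\<^sub>m Suc ?m * U"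
    using pow_matrix_index_factor[OF A] .
  \<comment> \<open>Substituting the factorization of \<open>A^m\<close> into itself
    \<open>i\<close> times splits off \<open>A^i\<close> on the left. With \<open>i = j\<close> the
    assumed power equation can be applied to \<open>A^m\<close>.\<close>
  have "\<exists>V \<in> carrier_mat n n. A ^\<^sub>m ?m = A ^\<^sub>m i * (A ^\<^sub>m ?m * V)" for i
  proof (induction i)
    case 0
    show ?case using A by (intro bexI[of _ "1\<^sub>m n"]) (auto simp: mat_dim_simps)
  next
    case (Suc i)
    then obtain V where V: "V \<in> carrier_mat n n" "A ^\<^sub>m ?m = A ^\<^sub>m i * (A ^\<^sub>m ?m * V)" by blast
    have "A ^\<^sub>m ?m = A ^\<^sub>m i * (A * A ^\<^sub>m ?m * U * V)"
      by (rule trans[OF V(2) arg_cong[OF U(2)[unfolded pow_mat_Suc_left[OF A]], of "\<lambda>Z. A ^\<^sub>m i * (Z * V)"]])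
    also have "\<dots> = A ^\<^sub>m Suc i * (A ^\<^sub>m ?m * (U * V))"
      using A U(1) V(1) by (simp add: mat_dim_simps)
    finally show ?case using U(1) V(1) by (intro bexI[of _ "U * V"]) auto
  qed
  from this[of j] obtain V where V: "V \<in> carrier_mat n n" "A ^\<^sub>m ?m = A ^\<^sub>m j * (A ^\<^sub>m ?m * V)" by (elim bexE)
  have "A ^\<^sub>m Suc ?m * X = A * X * A ^\<^sub>m ?m"
    using pow_mat_Suc_left[OF A, of ?m] pow_mat_commute[OF A X comm, of ?m] A X
    by (simp add: mat_dim_simps)
  also have "\<dots> = A * X * (A ^\<^sub>m j * (A ^\<^sub>m ?m * V))" by (rule arg_cong[OF V(2)])
  also have "\<dots> = A * (A ^\<^sub>m j * X) * (A ^\<^sub>m ?m * V)"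
    unfolding pow_mat_commute[OF A X comm] using A X V(1) by (simp add: mat_dim_simps)
  also have "\<dots> = A ^\<^sub>m j * (A ^\<^sub>m ?m * V)"
  proof -
    have "A * (A ^\<^sub>m j * X) = A ^\<^sub>m Suc j * X"
      using A X unfolding pow_mat_Suc_left[OF A] by (simp add: mat_dim_simps)
    then show ?thesis unfolding pow by simp
  qed
  also have "\<dots> = A ^\<^sub>m ?m" by (rule V(2)[symmetric])
  finally show ?thesis using A X outer comm by (simp add: is_drazin_inverse_def)
qed

text \<open>The idempotents \<open>A X\<close> and \<open>A Y\<close> agree, because
  \<open>A X\<close> factors through \<open>A^k\<close> on the left and \<open>A Y\<close> through
  \<open>A^k\<close> on the right, so \<open>A Y A X\<close> reduces to either of them. Then
  \<open>X = X A Y = A X Y = Y A Y = Y\<close>.\<close>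

lemma is_drazin_inverse_unique:
  assumes A: "A \<in> carrier_mat n n" and DX: "is_drazin_inverse A X" and DY: "is_drazin_inverse A Y"
  shows "X = Y"
proof -
  define k where "k = matrix_index A"
  from A DX have X: "X \<in> carrier_mat n n" "A ^\<^sub>m Suc k * X = A ^\<^sub>m k" "X * A * X = X" "A * X = X * A"
    by (auto simp: is_drazin_inverse_def k_def)
  from A DY have Y: "Y \<in> carrier_mat n n" "A ^\<^sub>m Suc k * Y = A ^\<^sub>m k" "Y * A * Y = Y" "A * Y = Y * A"
    by (auto simp: is_drazin_inverse_def k_def)
  have EE: "A * X * (A * X) = A * X"
    using A X(1,3) by (simp add: mat_dim_simps)
  have FF: "A * Y * (A * Y) = A * Y"
    using A Y(1,3) by (simp add: mat_dim_simps)
  \<comment> \<open>Idempotency supplies one more factor \<open>A X\<close> in each step, and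
    commutation moves its \<open>A\<close> next to \<open>A^j\<close>.\<close>
  have "\<exists>Z \<in> carrier_mat n n. A * X = A ^\<^sub>m j * Z" for j
  proof (induction j)
    case 0
    show ?case using A X by (intro bexI[of _ "A * X"]) (auto simp: mat_dim_simps)
  next
    case (Suc j)
    then obtain Z where Z: "Z \<in> carrier_mat n n" "A * X = A ^\<^sub>m j * Z" by blast
    have "A * X = A * X * (A ^\<^sub>m j * Z)" using EE Z(2) by simp
    also have "\<dots> = A * (X * A ^\<^sub>m j) * Z" using A X(1) Z(1) by (simp add: mat_dim_simps)
    also have "\<dots> = A * A ^\<^sub>m j * (X * Z)"
      unfolding pow_mat_commute[OF A X(1,4), symmetric] using A X(1) Z(1) by (simp add: mat_dim_simps)
    finally show ?case using X(1) Z(1) pow_mat_Suc_left[OF A, of j] by auto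
  qed
  then obtain Z where Z: "Z \<in> carrier_mat n n" "A * X = A ^\<^sub>m k * Z" by blast
  have "\<exists>W \<in> carrier_mat n n. A * Y = W * A ^\<^sub>m j" for j
  proof (induction j)
    case 0
    show ?case using A Y by (intro bexI[of _ "A * Y"]) (auto simp: mat_dim_simps)
  next
    case (Suc j)
    then obtain W where W: "W \<in> carrier_mat n n" "A * Y = W * A ^\<^sub>m j" by blast
    have "A * Y = W * A ^\<^sub>m j * (Y * A)" using FF W(2) Y(4) by simp
    also have "\<dots> = W * (A ^\<^sub>m j * Y) * A" using A Y(1) W(1) by (simp add: mat_dim_simps)
    also have "\<dots> = W * Y * A ^\<^sub>m Suc j"
      unfolding pow_mat_commute[OF A Y(1,4)] using A Y(1) W(1) by (simp add: mat_dim_simps)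
    finally show ?case using Y(1) W(1) by auto
  qed
  then obtain W where W: "W \<in> carrier_mat n n" "A * Y = W * A ^\<^sub>m k" by blast
  have "A * Y * (A * X) = A * (Y * A ^\<^sub>m k) * Z"
    using A X(1) Y(1) Z by (simp add: mat_dim_simps)
  also have "\<dots> = A * (A ^\<^sub>m k * Y) * Z" using pow_mat_commute[OF A Y(1,4)] by simp
  also have "\<dots> = A ^\<^sub>m Suc k * Y * Z"
    using pow_mat_Suc_left[OF A, of k] A Y(1) by (simp add: mat_dim_simps)
  finally have 1: "A * Y * (A * X) = A * X" using Y(2) Z(2) by simp
  have "A * Y * (A * X) = W * (A ^\<^sub>m Suc k * X)"
    using A X(1) W by (simp add: mat_dim_simps)
  then have 2: "A * Y * (A * X) = A * Y" using X(2) W(2) by simp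
  have EF: "A * X = A * Y" using 1 2 by simp
  have "X = X * (A * Y)" using X(3) EF A X(1) by (simp add: mat_dim_simps)
  also have "\<dots> = A * X * Y" using X(4) A X(1) Y(1) by (simp add: mat_dim_simps)
  also have "\<dots> = Y * A * Y" using EF Y(4) by simp
  finally show ?thesis using Y(3) by simp
qed

lemma drazin_inverse_eqI:
  assumes "A \<in> carrier_mat n n" "is_drazin_inverse A X"
  shows "drazin_inverse A = X"
  unfolding drazin_inverse_def using assms is_drazin_inverse_unique by (intro the_equality) auto

section \<open>Core-EP inverses\<close>

text \<open>The product \<open>Y A X\<close> is evaluated twice: \<open>X = Y U\<close> turns it
  into \<open>X\<close>, and \<open>Y = V^* X\<close>, obtained from the ranges of the adjoints,
  turns it into \<open>Y\<close>.\<close>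

lemma outer_inverse_unique:
  assumes A: "A \<in> carrier_mat n n" and X: "X \<in> carrier_mat n n" "X * A * X = X"
    and Y: "Y \<in> carrier_mat n n" "Y * A * Y = Y"
    and range: "range_mat X = range_mat Y" "range_mat (mat_adjoint X) = range_mat (mat_adjoint Y)"
  shows "X = Y"
proof -
  obtain U where U: "U \<in> carrier_mat n n" "X = Y * U"
    using range_mat_subset_imp_factor[OF X(1) Y(1) equalityD1[OF range(1)]] .
  obtain V where V: "V \<in> carrier_mat n n" "mat_adjoint Y = mat_adjoint X * V"
    using range_mat_subset_imp_factor[OF _ _ equalityD2[OF range(2)]] mat_adjoint_carrier X(1) Y(1)
    by blast
  have Y': "Y = mat_adjoint V * X"
    using arg_cong[OF V(2), of mat_adjoint] X(1) V(1) by (simp add: mat_adjoint_mult)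
  have "Y * A * X = X" 
    using Y(2) U Y(1) A mult_mat_assoc_dim[of "Y * A" Y U] by simp
  moreover have "Y * A * X = mat_adjoint V * (X * A * X)"
    using A X(1) V(1) by (subst Y') (simp add: mat_dim_simps)
  ultimately show ?thesis using X(2) Y' by simp
qed

text \<open>Any two candidates share both their range and the range of their adjoint, namely that of
  the Drazin inverse.\<close>

lemma core_EP_inverse_eqI:
  assumes "A \<in> carrier_mat n n" "is_core_EP_inverse A X"
  shows "core_EP_inverse A = X"
  unfolding core_EP_inverse_def
  using assms by (intro the_equality) (auto simp: is_core_EP_inverse_def intro!: outer_inverse_unique[of A n])

lemma dual_core_EP_inverse_eqI:
  assumes "A \<in> carrier_mat n n" "is_dual_core_EP_inverse A X"
  shows "dual_core_EP_inverse A = X"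
  unfolding dual_core_EP_inverse_def
  using assms by (intro the_equality) (auto simp: is_dual_core_EP_inverse_def intro!: outer_inverse_unique[of A n])

section \<open>Matrices with an invertible core\<close>

lemma pow_mat_mult_inverse:
  fixes M N :: "'a :: semiring_1 mat"
  assumes M: "M \<in> carrier_mat r r" and N: "N \<in> carrier_mat r r" and MN: "M * N = 1\<^sub>m r"
  shows "M ^\<^sub>m k * N ^\<^sub>m k = 1\<^sub>m r"
proof (induction k)
  case (Suc k)
  have "M ^\<^sub>m Suc k * N ^\<^sub>m Suc k = M ^\<^sub>m k * (M * (N * N ^\<^sub>m k))"
    using M N unfolding pow_mat_Suc_left[OF N] by (simp add: mat_dim_simps)
  also have "\<dots> = M ^\<^sub>m k * N ^\<^sub>m k"
    using M N mult_mat_rewrite_prefix[OF MN] by (simp add: mat_dim_simps)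
  finally show ?case using Suc by simp
qed (use M N in simp)

lemma range_mat_eqI:
  fixes X Y :: "complex mat"
  assumes "X = Y * U" "dim_col Y = dim_row U" "Y = X * V" "dim_col X = dim_row V"
  shows "range_mat X = range_mat Y"
  using range_mat_mult_subset[of Y U] range_mat_mult_subset[of X V] assms by (metis subset_antisym)

locale invertible_core =
  fixes A B G M N L R :: "complex mat" and n r k :: nat
  assumes A: "A \<in> carrier_mat n n" and B: "B \<in> carrier_mat n r" and G: "G \<in> carrier_mat r n"
    and M: "M \<in> carrier_mat r r" and N: "N \<in> carrier_mat r r"
    and L: "L \<in> carrier_mat r n" and R: "R \<in> carrier_mat n r"
    and AB: "A * B = B * M" and GA: "G * A = M * G" and BG: "B * G = A ^\<^sub>m k"
    and MN: "M * N = 1\<^sub>m r" and NM: "N * M = 1\<^sub>m r"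
    and LB: "L * B = 1\<^sub>m r" and GR: "G * R = 1\<^sub>m r"
begin

text \<open>Adjunction exchanges \<open>B\<close> with \<open>G\<close> and \<open>L\<close> with
  \<open>R\<close>; results on the core-EP inverse thereby become results on the dual one.\<close>

lemma adjoint:
  "invertible_core (mat_adjoint A) (mat_adjoint G) (mat_adjoint B) (mat_adjoint M) (mat_adjoint N)
     (mat_adjoint R) (mat_adjoint L) n r k"
proof
  show "mat_adjoint A * mat_adjoint G = mat_adjoint G * mat_adjoint M"
    using arg_cong[OF GA, of mat_adjoint] A G M by (simp add: mat_adjoint_mult)
  show "mat_adjoint B * mat_adjoint A = mat_adjoint M * mat_adjoint B"
    using arg_cong[OF AB, of mat_adjoint] A B M by (simp add: mat_adjoint_mult)
  show "mat_adjoint G * mat_adjoint B = mat_adjoint A ^\<^sub>m k"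
    using arg_cong[OF BG, of mat_adjoint] A B G by (simp add: mat_adjoint_mult mat_adjoint_pow)
  show "mat_adjoint M * mat_adjoint N = 1\<^sub>m r"
    using arg_cong[OF NM, of mat_adjoint] M N by (simp add: mat_adjoint_mult)
  show "mat_adjoint N * mat_adjoint M = 1\<^sub>m r"
    using arg_cong[OF MN, of mat_adjoint] M N by (simp add: mat_adjoint_mult)
  show "mat_adjoint R * mat_adjoint G = 1\<^sub>m r"
    using arg_cong[OF GR, of mat_adjoint] G R by (simp add: mat_adjoint_mult)
  show "mat_adjoint B * mat_adjoint L = 1\<^sub>m r"
    using arg_cong[OF LB, of mat_adjoint] L B by (simp add: mat_adjoint_mult)
qed (use A B G M N L R in auto)

text \<open>Since \<open>B G B = A^k B = B M^k\<close>, cancelling \<open>B\<close> by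
  \<open>L\<close> gives the claim.\<close>

lemma GB: "G * B = M ^\<^sub>m k"
proof -
  have pow: "A ^\<^sub>m j * B = B * M ^\<^sub>m j" for j
  proof (induction j)
    case (Suc j)
    have "A ^\<^sub>m Suc j * B = A ^\<^sub>m j * (B * M)" using A B AB by (simp add: mat_dim_simps)
    also have "\<dots> = A ^\<^sub>m j * B * M" using A B M by (simp add: mat_dim_simps)
    also have "\<dots> = B * M ^\<^sub>m Suc j" unfolding Suc using B M by (simp add: mat_dim_simps)
    finally show ?case .
  qed (use A B M in \<open>simp add: mat_dim_simps\<close>)
  have "G * B = L * B * (G * B)" using LB G B by (simp add: mat_dim_simps)
  also have "\<dots> = L * (B * G * B)" using L G B by (simp add: mat_dim_simps)
  also have "\<dots> = L * B * M ^\<^sub>m k" unfolding BG pow using L B M by (simp add: mat_dim_simps)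
  finally show ?thesis using LB M by (simp add: mat_dim_simps)
qed

text \<open>Multiplication by \<open>A\<close> from either side lowers the exponent of
  \<open>N\<close> by one, because \<open>A B = B M\<close> and \<open>G A = M G\<close>. In the
  remaining equations an inner \<open>G B = M^k\<close> cancels \<open>N^k\<close>.\<close>

lemma drazin_inverse_eq: "drazin_inverse A = B * N ^\<^sub>m Suc k * G"
proof (rule drazin_inverse_eqI[OF A is_drazin_inverseI[OF A, where j = k]])
  let ?X = "B * N ^\<^sub>m Suc k * G"
  show "?X \<in> carrier_mat n n" using B N G by (intro carrier_matI) auto
  have "M * N ^\<^sub>m Suc k = N ^\<^sub>m k"
    using M N mult_mat_rewrite_prefix[OF MN] unfolding pow_mat_Suc_left[OF N] by (simp add: mat_dim_simps)
  then have AX: "A * ?X = B * N ^\<^sub>m k * G"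
    using A B M N G mult_mat_rewrite_prefix[OF AB, of "N ^\<^sub>m Suc k * G"]
      mult_mat_rewrite_prefix[of M "N ^\<^sub>m Suc k" _ G] by (simp add: mat_dim_simps del: pow_mat.simps)
  have "N ^\<^sub>m Suc k * M = N ^\<^sub>m k"
    using M N NM by (simp add: mat_dim_simps)
  then have XA: "?X * A = B * N ^\<^sub>m k * G"
    using A B M N G GA mult_mat_rewrite_prefix[of "N ^\<^sub>m Suc k" M _ G] by (simp add: mat_dim_simps del: pow_mat.simps)
  show "A * ?X = ?X * A" using AX XA by simp
  have "?X * A * ?X = ?X * (A * ?X)"
    using A B N G by (simp add: mat_dim_simps del: pow_mat.simps)
  also have "\<dots> = B * (N ^\<^sub>m Suc k * (G * B * N ^\<^sub>m k * G))"
    unfolding AX using A B N G by (simp add: mat_dim_simps del: pow_mat.simps)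
  also have "\<dots> = B * (N ^\<^sub>m Suc k * G)"
    unfolding GB pow_mat_mult_inverse[OF M N MN] using G by (simp add: mat_dim_simps)
  finally show "?X * A * ?X = ?X" using B N G by (simp add: mat_dim_simps del: pow_mat.simps)
  have "A ^\<^sub>m Suc k * ?X = A ^\<^sub>m k * (A * ?X)"
    using A B N G by (simp add: mat_dim_simps)
  also have "\<dots> = B * (G * B * N ^\<^sub>m k * G)"
    unfolding AX unfolding BG[symmetric] using B N G by (simp add: mat_dim_simps)
  finally show "A ^\<^sub>m Suc k * ?X = A ^\<^sub>m k"
    unfolding GB pow_mat_mult_inverse[OF M N MN] BG[symmetric] using G by (simp add: mat_dim_simps)
qed

text \<open>The factor \<open>N^(k+1) G\<close> to the right of \<open>B\<close> has the right
  inverse \<open>R M^(k+1)\<close>, so \<open>B\<close> can be recovered.\<close>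

lemma range_drazin_inverse: "range_mat (drazin_inverse A) = range_mat B"
  unfolding drazin_inverse_eq
proof (rule range_mat_eqI)
  show "B * N ^\<^sub>m Suc k * G = B * (N ^\<^sub>m Suc k * G)" using B N G by (simp add: mat_dim_simps)
  have "B * N ^\<^sub>m Suc k * G * (R * M ^\<^sub>m Suc k) = B * (N ^\<^sub>m Suc k * (G * R * M ^\<^sub>m Suc k))"
    using B N G R M by (simp add: mat_dim_simps del: pow_mat.simps)
  also have "\<dots> = B"
    unfolding GR using pow_mat_mult_inverse[OF N M NM, of "Suc k"] B M
    by (simp add: mat_dim_simps del: pow_mat.simps)
  finally show "B = B * N ^\<^sub>m Suc k * G * (R * M ^\<^sub>m Suc k)" ..
qed (use B N G R M in auto)

text \<open>\<open>D\<close> is the inverse of the Gram matrix of \<open>P\<close>, so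
  \<open>D P^*\<close> is the Moore-Penrose inverse of \<open>P\<close>.\<close>

context
  fixes P D :: "complex mat"
  assumes P: "P = B * M" and D: "D \<in> carrier_mat r r"
    and DC: "D * (mat_adjoint P * P) = 1\<^sub>m r" and CD: "mat_adjoint P * P * D = 1\<^sub>m r"
begin

lemma P_carrier: "P \<in> carrier_mat n r"
  using P B M by simp

lemma mat_adjoint_D: "mat_adjoint D = D"
proof -
  have "mat_adjoint D * (mat_adjoint P * P) = 1\<^sub>m r"
    using arg_cong[OF CD, of mat_adjoint] P_carrier D by (simp add: mat_adjoint_mult mat_dim_simps)
  then have "mat_adjoint D * (mat_adjoint P * P) * D = D"
    using D by (simp add: mat_dim_simps)
  then show ?thesis
    using CD P_carrier D by (simp add: mat_dim_simps)
qed

text \<open>Everything rests on \<open>A B = P\<close> and \<open>X P = B\<close> for the candidate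
  \<open>X\<close>: they give \<open>X A X = X\<close> and show that \<open>X\<close> has the range
  of \<open>B\<close>. The adjoint \<open>P D B^*\<close> has the same range, since
  \<open>P = B M\<close> with \<open>M\<close> invertible.\<close>

lemma is_core_EP_inverse: "is_core_EP_inverse A (B * D * mat_adjoint P)"
proof -
  let ?X = "B * D * mat_adjoint P"
  have X: "?X \<in> carrier_mat n n" using B D P_carrier by (intro carrier_matI) auto
  have AB': "A * B = P" using AB P by simp
  have XP: "?X * P = B"
    using DC B D P_carrier by (simp add: mat_dim_simps)
  have "?X * A * ?X = ?X * (A * B) * (D * mat_adjoint P)"
    using A B D P_carrier by (simp add: mat_dim_simps)
  also have "\<dots> = ?X"
    unfolding AB' XP using B D P_carrier by (simp add: mat_dim_simps)
  finally have outer: "?X * A * ?X = ?X" .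
  have rX: "range_mat ?X = range_mat B"
    by (rule range_mat_eqI[of _ _ "D * mat_adjoint P" P])
      (use XP B D P_carrier in \<open>auto simp: mat_dim_simps\<close>)
  have adjX: "mat_adjoint ?X = P * (D * mat_adjoint B)"
    using B D P_carrier mat_adjoint_D by (simp add: mat_adjoint_mult mat_dim_simps)
  have "mat_adjoint B * mat_adjoint L = 1\<^sub>m r"
    using arg_cong[OF LB, of mat_adjoint] L B by (simp add: mat_adjoint_mult)
  then have "mat_adjoint ?X * mat_adjoint L = P * D"
    unfolding adjX using B D L P_carrier by (simp add: mat_dim_simps)
  \<comment> \<open>To recover \<open>B\<close> from \<open>P D B^*\<close>, the factor
    \<open>L^*\<close> cancels \<open>B^*\<close>, the Gram matrix cancels \<open>D\<close>, and
    \<open>N\<close> cancels the \<open>M\<close> in \<open>P\<close>.\<close>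
  then have "mat_adjoint ?X * (mat_adjoint L * (mat_adjoint P * P * N)) = P * (D * (mat_adjoint P * P)) * N"
    using B D L N P_carrier mult_mat_assoc_dim[of "mat_adjoint ?X" "mat_adjoint L" "mat_adjoint P * P * N"]
    by (simp add: mat_dim_simps)
  also have "\<dots> = B"
    unfolding DC using P B M N MN by (simp add: mat_dim_simps)
  finally have B_eq: "B = mat_adjoint ?X * (mat_adjoint L * (mat_adjoint P * P * N))" ..
  have rX': "range_mat (mat_adjoint ?X) = range_mat B"
    by (rule range_mat_eqI[OF _ _ B_eq, of "M * (D * mat_adjoint B)"])
      (use adjX P B D M L X P_carrier in \<open>auto simp: mat_dim_simps\<close>)
  show ?thesis
    unfolding is_core_EP_inverse_def range_drazin_inverse using X outer rX rX' A by simp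
qed

lemma core_EP_inverse_eq: "core_EP_inverse A = B * D * mat_adjoint P"
  using core_EP_inverse_eqI[OF A is_core_EP_inverse] .

end

end

text \<open>The equation \<open>X A^* X = X\<close> is adjoined, and the range conditions are
  symmetric in \<open>X\<close> and \<open>X^*\<close>.\<close>

lemma dual_core_EP_inverse_eq_adjoint:
  assumes A: "A \<in> carrier_mat n n" and X: "is_core_EP_inverse (mat_adjoint A) X"
  shows "dual_core_EP_inverse A = mat_adjoint X"
proof (rule dual_core_EP_inverse_eqI[OF A])
  from X A have X: "X \<in> carrier_mat n n" "X * mat_adjoint A * X = X"
    "range_mat X = range_mat (mat_adjoint X)"
    "range_mat (mat_adjoint X) = range_mat (drazin_inverse (mat_adjoint A))"
    by (auto simp: is_core_EP_inverse_def)
  have "mat_adjoint X * A * mat_adjoint X = mat_adjoint X"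
    using arg_cong[OF X(2), of mat_adjoint] X(1) A by (simp add: mat_adjoint_mult mat_dim_simps)
  then show "is_dual_core_EP_inverse A (mat_adjoint X)"
    using X A by (auto simp: is_dual_core_EP_inverse_def)
qed

section \<open>Limits of shifted Gram matrices\<close>

text \<open>By the Leibniz formula the determinant is a polynomial in the entries.\<close>

lemma tendsto_det:
  fixes f :: "'b \<Rightarrow> complex mat"
  assumes f: "\<And>t. f t \<in> carrier_mat m m" and C: "C \<in> carrier_mat m m"
    and lim: "\<And>i j. i < m \<Longrightarrow> j < m \<Longrightarrow> ((\<lambda>t. f t $$ (i, j)) \<longlongrightarrow> C $$ (i, j)) F"
  shows "((\<lambda>t. det (f t)) \<longlongrightarrow> det C) F"
  unfolding det_def'[OF f] det_def'[OF C]
proof (intro tendsto_intros lim)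
  fix p i assume "p \<in> {p. p permutes {0..<m}}" "i \<in> {0..<m}"
  then show "p i < m" "i < m" using permutes_in_image[of p "{0..<m}" i] by auto
qed

lemma mat_tendsto_entry:
  "mat_tendsto f L F \<Longrightarrow> i < dim_row L \<Longrightarrow> j < dim_col L \<Longrightarrow> ((\<lambda>t. f t $$ (i, j)) \<longlongrightarrow> L $$ (i, j)) F"
  by (simp add: mat_tendsto_def)

lemma mat_tendsto_const: "mat_tendsto (\<lambda>_. L) L F"
  by (simp add: mat_tendsto_def)

lemma mat_tendsto_cong:
  assumes "mat_tendsto f L F" "\<forall>\<^sub>F t in F. g t = f t"
  shows "mat_tendsto g L F"
proof -
  have ev: "\<forall>\<^sub>F t in F. f t $$ ij = g t $$ ij" for ij
    using assms(2) by (rule eventually_mono) simp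
  show ?thesis
    unfolding mat_tendsto_def
  proof (intro conjI allI impI)
    show "\<forall>\<^sub>F t in F. g t \<in> carrier_mat (dim_row L) (dim_col L)"
      using assms unfolding mat_tendsto_def by (auto elim: eventually_elim2)
    show "((\<lambda>t. g t $$ (i, j)) \<longlongrightarrow> L $$ (i, j)) F" if "i < dim_row L" "j < dim_col L" for i j
      using Lim_transform_eventually[OF mat_tendsto_entry[OF assms(1) that] ev] .
  qed
qed

lemma mat_tendsto_mult:
  assumes f: "mat_tendsto f L F" and g: "mat_tendsto g K F" and d: "dim_col L = dim_row K"
  shows "mat_tendsto (\<lambda>t. f t * g t) (L * K) F"
  unfolding mat_tendsto_def
proof (intro conjI allI impI)
  have carr: "\<forall>\<^sub>F t in F. f t \<in> carrier_mat (dim_row L) (dim_col L) \<and> g t \<in> carrier_mat (dim_row K) (dim_col K)"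
    using f g unfolding mat_tendsto_def by (auto intro: eventually_conj)
  then show "\<forall>\<^sub>F t in F. f t * g t \<in> carrier_mat (dim_row (L * K)) (dim_col (L * K))"
    by (rule eventually_mono) (use d in auto)
  fix i j assume "i < dim_row (L * K)" "j < dim_col (L * K)"
  then have ij: "i < dim_row L" "j < dim_col K" by auto
  have "((\<lambda>t. \<Sum>l<dim_row K. f t $$ (i, l) * g t $$ (l, j)) \<longlongrightarrow> (\<Sum>l<dim_row K. L $$ (i, l) * K $$ (l, j))) F"
    using ij d by (intro tendsto_intros mat_tendsto_entry[OF f] mat_tendsto_entry[OF g]) auto
  moreover have "(L * K) $$ (i, j) = (\<Sum>l<dim_row K. L $$ (i, l) * K $$ (l, j))"
    using ij d by (simp add: scalar_prod_def lessThan_atLeast0)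
  moreover have "\<forall>\<^sub>F t in F. (\<Sum>l<dim_row K. f t $$ (i, l) * g t $$ (l, j)) = (f t * g t) $$ (i, j)"
    using carr by (rule eventually_mono) (use ij d in \<open>auto simp: scalar_prod_def lessThan_atLeast0\<close>)
  ultimately show "((\<lambda>t. (f t * g t) $$ (i, j)) \<longlongrightarrow> (L * K) $$ (i, j)) F"
    using Lim_transform_eventually by force
qed

lemma mat_inv_eqI:
  fixes M X :: "complex mat"
  assumes M: "M \<in> carrier_mat n n" and X: "X \<in> carrier_mat n n" and MX: "M * X = 1\<^sub>m n"
  shows "mat_inv M = X"
proof (cases "mat_inverse M")
  case None
  \<comment> \<open>The value \<open>None\<close> is impossible, since a right inverse of a square
    matrix makes it a unit.\<close>
  have "M \<in> Units (ring_mat TYPE(complex) n ())"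
    using M X MX mat_mult_left_right_inverse[OF M X MX] by (auto simp: Units_def ring_mat_simps)
  then show ?thesis using mat_inverse(1)[OF M None, of "()"] by blast
next
  case (Some Y)
  then have Y: "Y \<in> carrier_mat n n" "Y * M = 1\<^sub>m n" using mat_inverse(2)[OF M] by auto
  have "Y = Y * (M * X)" using Y(1) MX by (simp add: mat_dim_simps)
  also have "\<dots> = Y * M * X" using Y(1) M X by (simp add: mult_mat_assoc_dim)
  finally show ?thesis using Some Y(2) X by (simp add: mat_dim_simps)
qed

text \<open>The adjugate formula expresses the inverse rationally in the entries, which is what the
  continuity argument needs.\<close>

lemma
  fixes M :: "complex mat"
  assumes M: "M \<in> carrier_mat n n" and det: "det M \<noteq> 0"
  shows mat_inv_eq_adj_mat: "mat_inv M = inverse (det M) \<cdot>\<^sub>m adj_mat M"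
    and mat_inv_carrier: "mat_inv M \<in> carrier_mat n n"
    and mat_inv_right: "M * mat_inv M = 1\<^sub>m n"
    and mat_inv_left: "mat_inv M * M = 1\<^sub>m n"
    and det_nonzero_invertible_mat: "invertible_mat M"
proof -
  let ?X = "inverse (det M) \<cdot>\<^sub>m adj_mat M"
  have X: "?X \<in> carrier_mat n n" using adj_mat(1)[OF M] by simp
  have MX: "M * ?X = 1\<^sub>m n"
    using mult_smult_distrib[OF M adj_mat(1)[OF M]] adj_mat(2)[OF M] det by (intro eq_matI) auto
  show eq: "mat_inv M = ?X" by (rule mat_inv_eqI[OF M X MX])
  show "mat_inv M \<in> carrier_mat n n" "M * mat_inv M = 1\<^sub>m n" "mat_inv M * M = 1\<^sub>m n"
    unfolding eq using X MX mat_mult_left_right_inverse[OF M X MX] by auto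
  show "invertible_mat M"
    unfolding invertible_mat_def inverts_mat_def
    using M X MX mat_mult_left_right_inverse[OF M X MX] by (intro conjI exI[of _ ?X]) auto
qed

text \<open>Entries of the inverse are cofactors divided by the determinant; all of these converge,
  and the limit of the determinant is nonzero.\<close>

lemma
  fixes C D :: "complex mat"
  assumes C: "C \<in> carrier_mat r r" and D: "D \<in> carrier_mat r r" and CD: "C * D = 1\<^sub>m r"
  shows eventually_det_shift_nonzero: "\<forall>\<^sub>F t in at 0. det (C + t \<cdot>\<^sub>m 1\<^sub>m r) \<noteq> 0"
    and mat_tendsto_inv_shift: "mat_tendsto (\<lambda>t. mat_inv (C + t \<cdot>\<^sub>m 1\<^sub>m r)) D (at 0)"
proof -
  let ?f = "\<lambda>t. C + t \<cdot>\<^sub>m 1\<^sub>m r"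
  have f: "?f t \<in> carrier_mat r r" for t using C by simp
  have lim: "((\<lambda>t. ?f t $$ (i, j)) \<longlongrightarrow> C $$ (i, j)) (at 0)" if "i < r" "j < r" for i j
  proof -
    have "((\<lambda>t. C $$ (i, j) + t * 1\<^sub>m r $$ (i, j)) \<longlongrightarrow> C $$ (i, j) + 0 * 1\<^sub>m r $$ (i, j)) (at 0)"
      by (intro tendsto_intros)
    then show ?thesis using that C by simp
  qed
  have det0: "det C \<noteq> 0"
    using det_mult[OF C D] CD by auto
  have detlim: "((\<lambda>t. det (?f t)) \<longlongrightarrow> det C) (at 0)"
    by (rule tendsto_det[OF f C lim])
  show ev: "\<forall>\<^sub>F t in at 0. det (?f t) \<noteq> 0"
    using tendsto_imp_eventually_ne[OF detlim det0] .
  have D_eq: "D = inverse (det C) \<cdot>\<^sub>m adj_mat C"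
    using mat_inv_eqI[OF C D CD] mat_inv_eq_adj_mat[OF C det0] by simp
  have "mat_tendsto (\<lambda>t. inverse (det (?f t)) \<cdot>\<^sub>m adj_mat (?f t)) D (at 0)"
    unfolding mat_tendsto_def
  proof (intro conjI allI impI)
    have "inverse (det (?f t)) \<cdot>\<^sub>m adj_mat (?f t) \<in> carrier_mat (dim_row D) (dim_col D)" for t
      using adj_mat(1)[OF f[of t]] D by simp
    then show "\<forall>\<^sub>F t in at 0. inverse (det (?f t)) \<cdot>\<^sub>m adj_mat (?f t) \<in> carrier_mat (dim_row D) (dim_col D)"
      by simp
    fix i j assume "i < dim_row D" "j < dim_col D"
    then have ij: "i < r" "j < r" using D by auto
    \<comment> \<open>The adjugate is the transposed cofactor matrix, so its entry
      \<open>(i, j)\<close> deletes row \<open>j\<close> and column \<open>i\<close>.\<close>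
    have del: "mat_delete X j i \<in> carrier_mat (r - 1) (r - 1)" if "X \<in> carrier_mat r r" for X :: "complex mat"
      using that by (simp add: mat_delete_def)
    have delim: "((\<lambda>t. mat_delete (?f t) j i $$ (a, b)) \<longlongrightarrow> mat_delete C j i $$ (a, b)) (at 0)"
      if "a < r - 1" "b < r - 1" for a b
    proof -
      \<comment> \<open>The position in the full matrix of entry \<open>(a, b)\<close> of the minor:
        indices at or past the deleted row or column shift by one.\<close>
      define a' b' where "a' = (if a < j then a else Suc a)" and "b' = (if b < i then b else Suc b)"
      have e: "mat_delete X j i $$ (a, b) = X $$ (a', b')" if "X \<in> carrier_mat r r" for X :: "complex mat"
        using that \<open>a < r - 1\<close> \<open>b < r - 1\<close> by (simp add: mat_delete_def a'_def b'_def)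
      have "a' < r" "b' < r" using that by (auto simp: a'_def b'_def)
      then show ?thesis unfolding e[OF f] e[OF C] by (rule lim)
    qed
    have "((\<lambda>t. det (mat_delete (?f t) j i)) \<longlongrightarrow> det (mat_delete C j i)) (at 0)"
      by (rule tendsto_det[OF del[OF f] del[OF C] delim])
    then have "((\<lambda>t. inverse (det (?f t)) * ((-1) ^ (j + i) * det (mat_delete (?f t) j i)))
        \<longlongrightarrow> inverse (det C) * ((-1) ^ (j + i) * det (mat_delete C j i))) (at 0)"
      by (intro tendsto_intros detlim det0)
    moreover have "(inverse (det X) \<cdot>\<^sub>m adj_mat X) $$ (i, j)
        = inverse (det X) * ((-1) ^ (j + i) * det (mat_delete X j i))"
      if "X \<in> carrier_mat r r" for X :: "complex mat"
      using that ij by (simp add: adj_mat_def cofactor_def)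
    ultimately show "((\<lambda>t. (inverse (det (?f t)) \<cdot>\<^sub>m adj_mat (?f t)) $$ (i, j)) \<longlongrightarrow> D $$ (i, j)) (at 0)"
      using f C D_eq by simp
  qed
  then show "mat_tendsto (\<lambda>t. mat_inv (?f t)) D (at 0)"
    by (rule mat_tendsto_cong) (use ev mat_inv_eq_adj_mat[OF f] in \<open>auto elim: eventually_mono\<close>)
qed

section \<open>Exchanging the two shifted Gram matrices of \<open>P\<close>\<close>

lemma shifted_gram_push_through:
  fixes P :: "complex mat"
  assumes P: "P \<in> carrier_mat n r"
  shows "mat_adjoint P * (P * mat_adjoint P + t \<cdot>\<^sub>m 1\<^sub>m n) = (mat_adjoint P * P + t \<cdot>\<^sub>m 1\<^sub>m r) * mat_adjoint P"
proof -
  have P': "mat_adjoint P \<in> carrier_mat r n" using P by simp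
  have "mat_adjoint P * (P * mat_adjoint P + t \<cdot>\<^sub>m 1\<^sub>m n)
      = mat_adjoint P * (P * mat_adjoint P) + mat_adjoint P * (t \<cdot>\<^sub>m 1\<^sub>m n)"
    using P P' by (intro mult_add_distrib_mat) auto
  also have "mat_adjoint P * (t \<cdot>\<^sub>m 1\<^sub>m n) = t \<cdot>\<^sub>m mat_adjoint P"
    using mult_smult_distrib[OF P' one_carrier_mat] P by (simp add: mat_dim_simps)
  also have "t \<cdot>\<^sub>m mat_adjoint P = (t \<cdot>\<^sub>m 1\<^sub>m r) * mat_adjoint P"
    using mult_smult_assoc_mat[OF one_carrier_mat P'] P by (simp add: mat_dim_simps)
  also have "mat_adjoint P * (P * mat_adjoint P) = mat_adjoint P * P * mat_adjoint P"
    using P by (simp add: mat_dim_simps)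
  also have "mat_adjoint P * P * mat_adjoint P + (t \<cdot>\<^sub>m 1\<^sub>m r) * mat_adjoint P
      = (mat_adjoint P * P + t \<cdot>\<^sub>m 1\<^sub>m r) * mat_adjoint P"
    using P P' by (intro add_mult_distrib_mat[symmetric]) auto
  finally show ?thesis .
qed

text \<open>For a kernel vector \<open>v\<close> of the large shifted matrix, pushing
  \<open>P^*\<close> through shows that the small one annihilates \<open>P^* v\<close>. Hence
  \<open>P^* v = 0\<close>, what remains is \<open>t v = 0\<close>, and \<open>t\<close> is
  nonzero.\<close>

lemma det_shifted_gram_nonzero:
  fixes P :: "complex mat"
  assumes P: "P \<in> carrier_mat n r" and t: "t \<noteq> 0"
    and det: "det (mat_adjoint P * P + t \<cdot>\<^sub>m 1\<^sub>m r) \<noteq> 0"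
  shows "det (P * mat_adjoint P + t \<cdot>\<^sub>m 1\<^sub>m n) \<noteq> 0"
proof
  let ?F = "mat_adjoint P * P + t \<cdot>\<^sub>m 1\<^sub>m r" and ?E = "P * mat_adjoint P + t \<cdot>\<^sub>m 1\<^sub>m n"
  have P': "mat_adjoint P \<in> carrier_mat r n" using P by simp
  have E: "?E \<in> carrier_mat n n" and F: "?F \<in> carrier_mat r r" using P P' by auto
  assume "det ?E = 0"
  then obtain v where v: "v \<in> carrier_vec n" "v \<noteq> 0\<^sub>v n" "?E *\<^sub>v v = 0\<^sub>v n"
    using det_0_iff_vec_prod_zero_field[OF E] by blast
  have w: "mat_adjoint P *\<^sub>v v \<in> carrier_vec r" using P' v(1) by simp
  have "?F *\<^sub>v (mat_adjoint P *\<^sub>v v) = (?F * mat_adjoint P) *\<^sub>v v"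
    using assoc_mult_mat_vec[OF F P' v(1)] by simp
  also have "\<dots> = mat_adjoint P *\<^sub>v (?E *\<^sub>v v)"
    using assoc_mult_mat_vec[OF P' E v(1)] shifted_gram_push_through[OF P, of t] by simp
  also have "\<dots> = 0\<^sub>v r" unfolding v(3) using P by (intro eq_vecI) auto
  finally have "mat_adjoint P *\<^sub>v v = 0\<^sub>v r"
    using det_0_iff_vec_prod_zero_field[OF F] det w by blast
  then have "(P * mat_adjoint P) *\<^sub>v v = 0\<^sub>v n"
    using assoc_mult_mat_vec[OF P P' v(1)] P by (auto intro!: eq_vecI)
  moreover have "?E *\<^sub>v v = (P * mat_adjoint P) *\<^sub>v v + (t \<cdot>\<^sub>m 1\<^sub>m n) *\<^sub>v v"
    using P P' v(1) by (intro add_mult_distrib_mat_vec) auto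
  moreover have "(t \<cdot>\<^sub>m 1\<^sub>m n) *\<^sub>v v = t \<cdot>\<^sub>v v"
    using v(1) by auto
  ultimately have "t \<cdot>\<^sub>v v = 0\<^sub>v n" using v by simp
  then have "v $ i = 0" if "i < n" for i
    using that t v(1) by (metis index_smult_vec(1) index_zero_vec(1) carrier_vecD mult_eq_0_iff)
  then show False using v(1,2) by auto
qed

lemma
  fixes P D :: "complex mat"
  assumes P: "P \<in> carrier_mat n r" and D: "D \<in> carrier_mat r r" and CD: "mat_adjoint P * P * D = 1\<^sub>m r"
  shows eventually_det_gram_right_nonzero: "\<forall>\<^sub>F t in at 0. det (P * mat_adjoint P + t \<cdot>\<^sub>m 1\<^sub>m n) \<noteq> 0"
    and eventually_invertible_gram_left: "\<forall>\<^sub>F t in at 0. invertible_mat (mat_adjoint P * P + t \<cdot>\<^sub>m 1\<^sub>m r)"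
    and eventually_invertible_gram_right: "\<forall>\<^sub>F t in at 0. invertible_mat (P * mat_adjoint P + t \<cdot>\<^sub>m 1\<^sub>m n)"
    and mat_tendsto_gram_left:
      "mat_tendsto (\<lambda>t. mat_inv (mat_adjoint P * P + t \<cdot>\<^sub>m 1\<^sub>m r)) D (at 0)"
    and eventually_push_through_left:
      "\<forall>\<^sub>F t in at 0. mat_adjoint P * mat_inv (P * mat_adjoint P + t \<cdot>\<^sub>m 1\<^sub>m n)
         = mat_inv (mat_adjoint P * P + t \<cdot>\<^sub>m 1\<^sub>m r) * mat_adjoint P"
    and eventually_push_through_right:
      "\<forall>\<^sub>F t in at 0. mat_inv (P * mat_adjoint P + t \<cdot>\<^sub>m 1\<^sub>m n) * P
         = P * mat_inv (mat_adjoint P * P + t \<cdot>\<^sub>m 1\<^sub>m r)"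
proof -
  let ?F = "\<lambda>t. mat_adjoint P * P + t \<cdot>\<^sub>m 1\<^sub>m r" and ?E = "\<lambda>t. P * mat_adjoint P + t \<cdot>\<^sub>m 1\<^sub>m n"
  have P': "mat_adjoint P \<in> carrier_mat r n" using P by simp
  have C: "mat_adjoint P * P \<in> carrier_mat r r" using P P' by auto
  have E: "?E t \<in> carrier_mat n n" and F: "?F t \<in> carrier_mat r r" for t using P P' by auto
  have evF: "\<forall>\<^sub>F t in at 0. det (?F t) \<noteq> 0"
    by (rule eventually_det_shift_nonzero[OF C D CD])
  \<comment> \<open>The filter \<open>at 0\<close> excludes \<open>t = 0\<close>, where
    \<open>P P^*\<close> may be singular.\<close>
  have ev: "\<forall>\<^sub>F t in at 0. det (?F t) \<noteq> 0 \<and> det (?E t) \<noteq> 0"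
    using evF eventually_neq_at_within[of 0 0 UNIV]
    by eventually_elim (use det_shifted_gram_nonzero[OF P] in auto)
  then show "\<forall>\<^sub>F t in at 0. det (?E t) \<noteq> 0" by (rule eventually_mono) simp
  show "\<forall>\<^sub>F t in at 0. invertible_mat (?F t)" "\<forall>\<^sub>F t in at 0. invertible_mat (?E t)"
    using ev by (auto elim!: eventually_mono intro: det_nonzero_invertible_mat[OF F] det_nonzero_invertible_mat[OF E])
  show "mat_tendsto (\<lambda>t. mat_inv (?F t)) D (at 0)"
    by (rule mat_tendsto_inv_shift[OF C D CD])
  have left: "mat_adjoint P * mat_inv (?E t) = mat_inv (?F t) * mat_adjoint P"
    if "det (?F t) \<noteq> 0" "det (?E t) \<noteq> 0" for t
  proof -
    note S = mat_inv_carrier[OF F that(1)] mat_inv_left[OF F that(1)]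
    note T = mat_inv_carrier[OF E that(2)] mat_inv_right[OF E that(2)]
    have "mat_inv (?F t) * mat_adjoint P * (?E t * mat_inv (?E t))
        = mat_inv (?F t) * (mat_adjoint P * ?E t) * mat_inv (?E t)"
      using S(1) T(1) P by (simp add: mult_mat_assoc_dim)
    also have "\<dots> = mat_inv (?F t) * ?F t * (mat_adjoint P * mat_inv (?E t))"
      unfolding shifted_gram_push_through[OF P] using S(1) T(1) P by (simp add: mult_mat_assoc_dim)
    finally show ?thesis unfolding S(2) T(2) using S(1) T(1) P by (simp add: mat_dim_simps)
  qed
  show "\<forall>\<^sub>F t in at 0. mat_adjoint P * mat_inv (?E t) = mat_inv (?F t) * mat_adjoint P"
    using ev by (rule eventually_mono) (use left in blast)
  have right: "mat_inv (?E t) * P = P * mat_inv (?F t)"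
    if "det (?F t) \<noteq> 0" "det (?E t) \<noteq> 0" for t
  proof -
    note S = mat_inv_carrier[OF F that(1)] mat_inv_right[OF F that(1)]
    note T = mat_inv_carrier[OF E that(2)] mat_inv_left[OF E that(2)]
    \<comment> \<open>The mirror image of the push-through identity: both sides expand to
      \<open>P P^* P + t P\<close>.\<close>
    have push: "?E t * P = P * ?F t"
    proof -
      have "P * ?F t = P * (mat_adjoint P * P) + P * (t \<cdot>\<^sub>m 1\<^sub>m r)"
        using P P' by (intro mult_add_distrib_mat) auto
      also have "P * (t \<cdot>\<^sub>m 1\<^sub>m r) = t \<cdot>\<^sub>m P"
        using mult_smult_distrib[OF P one_carrier_mat] P by (simp add: mat_dim_simps)
      also have "t \<cdot>\<^sub>m P = (t \<cdot>\<^sub>m 1\<^sub>m n) * P"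
        using mult_smult_assoc_mat[OF one_carrier_mat P] P by (simp add: mat_dim_simps)
      also have "P * (mat_adjoint P * P) = P * mat_adjoint P * P"
        using P by (simp add: mat_dim_simps)
      also have "P * mat_adjoint P * P + (t \<cdot>\<^sub>m 1\<^sub>m n) * P = ?E t * P"
        using P P' by (intro add_mult_distrib_mat[symmetric]) auto
      finally show ?thesis ..
    qed
    have "mat_inv (?E t) * ?E t * (P * mat_inv (?F t)) = mat_inv (?E t) * (?E t * P) * mat_inv (?F t)"
      using S(1) T(1) P by (simp add: mult_mat_assoc_dim)
    also have "\<dots> = mat_inv (?E t) * P * (?F t * mat_inv (?F t))"
      unfolding push using S(1) T(1) P by (simp add: mult_mat_assoc_dim)
    finally show ?thesis unfolding S(2) T(2) using S(1) T(1) P by (simp add: mat_dim_simps)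
  qed
  show "\<forall>\<^sub>F t in at 0. mat_inv (?E t) * P = P * mat_inv (?F t)"
    using ev by (rule eventually_mono) (use right in blast)
qed

section \<open>Limit formulas for the core-EP and dual core-EP inverses\<close>

context invertible_core
begin

text \<open>\<open>B M\<close> has the left inverse \<open>N L\<close>, so it is injective and its
  Gram matrix is nonsingular.\<close>

lemma gram_inverse:
  obtains D where "D \<in> carrier_mat r r"
    "D * (mat_adjoint (B * M) * (B * M)) = 1\<^sub>m r" "mat_adjoint (B * M) * (B * M) * D = 1\<^sub>m r"
proof -
  have P: "B * M \<in> carrier_mat n r" using B M by simp
  have NLP: "N * L * (B * M) = 1\<^sub>m r"
    using B M N L NM mult_mat_rewrite_prefix[OF LB, of M] by (simp add: mat_dim_simps)
  have "v = 0\<^sub>v r" if "v \<in> carrier_vec r" "(B * M) *\<^sub>v v = 0\<^sub>v n" for v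
  proof -
    have "v = (N * L * (B * M)) *\<^sub>v v" using that(1) unfolding NLP by simp
    also have "\<dots> = (N * L) *\<^sub>v 0\<^sub>v n"
      using assoc_mult_mat_vec[of "N * L" r n "B * M" r v] N L P that by simp
    also have "\<dots> = 0\<^sub>v r" using N L by (intro mult_mat_zero_vec) simp
    finally show ?thesis .
  qed
  then have "det (mat_adjoint (B * M) * (B * M)) \<noteq> 0"
    by (rule det_adjoint_mult_self_nonzero[OF P])
  moreover have "mat_adjoint (B * M) * (B * M) \<in> carrier_mat r r"
    by (rule mult_carrier_mat[OF mat_adjoint_carrier[OF P] P])
  ultimately show ?thesis using det_nonzero_obtain_inverse that by metis
qed

text \<open>The limit with \<open>P^* P\<close> follows factor by factor. The inverse with
  \<open>P P^*\<close> need not converge by itself, so that expression is first identified with the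
  other one for small nonzero \<open>t\<close>.\<close>

lemma core_EP_inverse_limits:
  assumes P: "P = B * M"
  shows "\<forall>\<^sub>F t in at 0. invertible_mat (P * mat_adjoint P + t \<cdot>\<^sub>m 1\<^sub>m n)"
    and "mat_tendsto (\<lambda>t. B * mat_adjoint P * mat_inv (P * mat_adjoint P + t \<cdot>\<^sub>m 1\<^sub>m n))
      (core_EP_inverse A) (at 0)"
    and "\<forall>\<^sub>F t in at 0. invertible_mat (mat_adjoint P * P + t \<cdot>\<^sub>m 1\<^sub>m r)"
    and "mat_tendsto (\<lambda>t. B * mat_inv (mat_adjoint P * P + t \<cdot>\<^sub>m 1\<^sub>m r) * mat_adjoint P)
      (core_EP_inverse A) (at 0)"
proof -
  let ?S = "\<lambda>t. mat_inv (mat_adjoint P * P + t \<cdot>\<^sub>m 1\<^sub>m r)"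
  let ?T = "\<lambda>t. mat_inv (P * mat_adjoint P + t \<cdot>\<^sub>m 1\<^sub>m n)"
  obtain D where D: "D \<in> carrier_mat r r" "D * (mat_adjoint P * P) = 1\<^sub>m r" "mat_adjoint P * P * D = 1\<^sub>m r"
    using gram_inverse unfolding P .
  note Pc = P_carrier[OF P D]
  show "\<forall>\<^sub>F t in at 0. invertible_mat (P * mat_adjoint P + t \<cdot>\<^sub>m 1\<^sub>m n)"
    by (rule eventually_invertible_gram_right[OF Pc D(1,3)])
  show "\<forall>\<^sub>F t in at 0. invertible_mat (mat_adjoint P * P + t \<cdot>\<^sub>m 1\<^sub>m r)"
    by (rule eventually_invertible_gram_left[OF Pc D(1,3)])
  have S: "mat_tendsto ?S D (at 0)" by (rule mat_tendsto_gram_left[OF Pc D(1,3)])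
  have eq: "core_EP_inverse A = B * D * mat_adjoint P" by (rule core_EP_inverse_eq[OF P D])
  show lim: "mat_tendsto (\<lambda>t. B * ?S t * mat_adjoint P) (core_EP_inverse A) (at 0)"
    unfolding eq using B D(1) Pc by (intro mat_tendsto_mult mat_tendsto_const S) auto
  have "\<forall>\<^sub>F t in at 0. ?S t \<in> carrier_mat r r"
    using S D(1) by (auto simp: mat_tendsto_def)
  moreover have "\<forall>\<^sub>F t in at 0. ?T t \<in> carrier_mat n n"
    using eventually_det_gram_right_nonzero[OF Pc D(1,3)] by eventually_elim (use Pc in \<open>auto intro!: mat_inv_carrier\<close>)
  ultimately have "\<forall>\<^sub>F t in at 0. B * mat_adjoint P * ?T t = B * ?S t * mat_adjoint P"
    using eventually_push_through_left[OF Pc D(1,3)]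
  proof eventually_elim
    case (elim t)
    have "B * mat_adjoint P * ?T t = B * (mat_adjoint P * ?T t)"
      using B Pc elim(2) by (intro assoc_mult_mat[of _ n r _ n _ n]) auto
    also have "\<dots> = B * ?S t * mat_adjoint P"
      unfolding elim(3) using B Pc elim(1) by (intro assoc_mult_mat[symmetric, of _ n r _ r _ n]) auto
    finally show ?case .
  qed
  then show "mat_tendsto (\<lambda>t. B * mat_adjoint P * ?T t) (core_EP_inverse A) (at 0)"
    by (rule mat_tendsto_cong[OF lim])
qed

text \<open>The adjoint instance is used with \<open>P = Q^*\<close>, so \<open>Q Q^*\<close> is now
  the Gram matrix with a nonsingular limit and \<open>Q^* Q\<close> the one handled by
  push-through.\<close>

lemma dual_core_EP_inverse_limits:
  assumes Q: "Q = M * G"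
  shows "\<forall>\<^sub>F t in at 0. invertible_mat (mat_adjoint Q * Q + t \<cdot>\<^sub>m 1\<^sub>m n)"
    and "mat_tendsto (\<lambda>t. mat_inv (mat_adjoint Q * Q + t \<cdot>\<^sub>m 1\<^sub>m n) * mat_adjoint Q * G)
      (dual_core_EP_inverse A) (at 0)"
    and "\<forall>\<^sub>F t in at 0. invertible_mat (Q * mat_adjoint Q + t \<cdot>\<^sub>m 1\<^sub>m r)"
    and "mat_tendsto (\<lambda>t. mat_adjoint Q * mat_inv (Q * mat_adjoint Q + t \<cdot>\<^sub>m 1\<^sub>m r) * G)
      (dual_core_EP_inverse A) (at 0)"
proof -
  interpret adj: invertible_core "mat_adjoint A" "mat_adjoint G" "mat_adjoint B" "mat_adjoint M"
    "mat_adjoint N" "mat_adjoint R" "mat_adjoint L" n r k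
    by (rule adjoint)
  let ?P = "mat_adjoint Q"
  let ?S = "\<lambda>t. mat_inv (Q * ?P + t \<cdot>\<^sub>m 1\<^sub>m r)"
  have P: "?P = mat_adjoint G * mat_adjoint M" using Q M G by (simp add: mat_adjoint_mult)
  obtain D where D: "D \<in> carrier_mat r r" "D * (mat_adjoint ?P * ?P) = 1\<^sub>m r" "mat_adjoint ?P * ?P * D = 1\<^sub>m r"
    using adj.gram_inverse unfolding P .
  note Pc = adj.P_carrier[OF P D]
  have Qc: "Q \<in> carrier_mat r n" using Q M G by simp
  show "\<forall>\<^sub>F t in at 0. invertible_mat (mat_adjoint Q * Q + t \<cdot>\<^sub>m 1\<^sub>m n)"
    using eventually_invertible_gram_right[OF Pc D(1,3)] by simp
  show "\<forall>\<^sub>F t in at 0. invertible_mat (Q * mat_adjoint Q + t \<cdot>\<^sub>m 1\<^sub>m r)"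
    using eventually_invertible_gram_left[OF Pc D(1,3)] by simp
  have S: "mat_tendsto ?S D (at 0)" using mat_tendsto_gram_left[OF Pc D(1,3)] by simp
  \<comment> \<open>The core-EP inverse of \<open>A^*\<close> is \<open>G^* D Q\<close>; its adjoint
    has this form because \<open>D\<close> is Hermitian.\<close>
  have eq: "dual_core_EP_inverse A = ?P * D * G"
    using dual_core_EP_inverse_eq_adjoint[OF A adj.is_core_EP_inverse[OF P D]] adj.mat_adjoint_D[OF P D] D(1) G Qc
    by (simp add: mat_adjoint_mult mat_dim_simps)
  show lim: "mat_tendsto (\<lambda>t. ?P * ?S t * G) (dual_core_EP_inverse A) (at 0)"
    unfolding eq using G D(1) Pc by (intro mat_tendsto_mult mat_tendsto_const S) auto
  show "mat_tendsto (\<lambda>t. mat_inv (?P * Q + t \<cdot>\<^sub>m 1\<^sub>m n) * ?P * G) (dual_core_EP_inverse A) (at 0)"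
    using eventually_push_through_right[OF Pc D(1,3)]
    by (intro mat_tendsto_cong[OF lim]) (auto elim: eventually_mono)
qed

end

section \<open>The chain of full-rank decompositions\<close>

lemma full_rank_decomposition_one_sided_inverses:
  assumes M: "M \<in> carrier_mat p q" and dec: "full_rank_decomposition M F H"
  obtains r L R where "F \<in> carrier_mat p r" "H \<in> carrier_mat r q" "L \<in> carrier_mat r p" "R \<in> carrier_mat q r"
    "L * F = 1\<^sub>m r" "H * R = 1\<^sub>m r" "M = F * H"
proof -
  let ?r = "rk M"
  have F: "F \<in> carrier_mat p ?r" "rk F = ?r" and H: "H \<in> carrier_mat ?r q" "rk H = ?r" and "M = F * H"
    using dec M by (auto simp: full_rank_decomposition_def)
  moreover obtain L where "L \<in> carrier_mat ?r p" "L * F = 1\<^sub>m ?r"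
    using full_col_rank_left_inverse[OF F] .
  moreover obtain R where "R \<in> carrier_mat q ?r" "H * R = 1\<^sub>m ?r"
    using full_row_rank_right_inverse[OF H] .
  ultimately show ?thesis using that by blast
qed

text \<open>The induction carries the intertwining relations with the current core
  \<open>G_i B_i\<close>. Replacing this core by \<open>B_(i+1) G_(i+1)\<close> re-establishes them
  for the next one. The inner dimensions are existential because they vary with
  \<open>i\<close>.\<close>

lemma full_rank_decomposition_chain:
  assumes A: "A \<in> carrier_mat n n"
    and decomp_1: "full_rank_decomposition A (Bs 1) (Gs 1)"
    and decomp: "\<And>i. 1 \<le> i \<Longrightarrow> i \<le> k - 1 \<Longrightarrow>
      full_rank_decomposition (Gs i * Bs i) (Bs (i + 1)) (Gs (i + 1))"
    and i: "1 \<le> i" "i \<le> k"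
  shows "\<exists>q r L R. Bs i \<in> carrier_mat q r \<and> Gs i \<in> carrier_mat r q \<and>
    prod_up n Bs i \<in> carrier_mat n r \<and> prod_down n Gs i \<in> carrier_mat r n \<and>
    L \<in> carrier_mat r n \<and> R \<in> carrier_mat n r \<and>
    L * prod_up n Bs i = 1\<^sub>m r \<and> prod_down n Gs i * R = 1\<^sub>m r \<and>
    A * prod_up n Bs i = prod_up n Bs i * (Gs i * Bs i) \<and>
    prod_down n Gs i * A = Gs i * Bs i * prod_down n Gs i \<and>
    prod_up n Bs i * prod_down n Gs i = A ^\<^sub>m i"
  using i
proof (induction i rule: nat_induct_at_least)
  case base
  obtain r L R where *: "Bs 1 \<in> carrier_mat n r" "Gs 1 \<in> carrier_mat r n" "L \<in> carrier_mat r n" "R \<in> carrier_mat n r"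
    "L * Bs 1 = 1\<^sub>m r" "Gs 1 * R = 1\<^sub>m r" "A = Bs 1 * Gs 1"
    using full_rank_decomposition_one_sided_inverses[OF A decomp_1] .
  have up: "prod_up n Bs 1 = Bs 1" and down: "prod_down n Gs 1 = Gs 1"
    using *(1,2) by (simp_all add: mat_dim_simps)
  have "A * Bs 1 = Bs 1 * (Gs 1 * Bs 1)" "Gs 1 * A = Gs 1 * Bs 1 * Gs 1"
    unfolding *(7) using *(1,2) by (simp_all add: mat_dim_simps)
  moreover have "Bs 1 * Gs 1 = A ^\<^sub>m 1"
    using *(7) A by (simp add: mat_dim_simps)
  ultimately show ?case unfolding up down using *(1-6) by blast
next
  case (Suc i)
  let ?B = "Bs (i + 1)" and ?G = "Gs (i + 1)" and ?U = "prod_up n Bs i" and ?V = "prod_down n Gs i"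
  from Suc obtain q r L R where IH:
    "Bs i \<in> carrier_mat q r" "Gs i \<in> carrier_mat r q" "?U \<in> carrier_mat n r" "?V \<in> carrier_mat r n"
    "L \<in> carrier_mat r n" "R \<in> carrier_mat n r" "L * ?U = 1\<^sub>m r" "?V * R = 1\<^sub>m r"
    "A * ?U = ?U * (Gs i * Bs i)" "?V * A = Gs i * Bs i * ?V" "?U * ?V = A ^\<^sub>m i"
    by (metis Suc_leD)
  have GB: "Gs i * Bs i \<in> carrier_mat r r" using IH(1,2) by simp
  have "full_rank_decomposition (Gs i * Bs i) ?B ?G"
    using decomp Suc.hyps Suc.prems by simp
  from full_rank_decomposition_one_sided_inverses[OF GB this]
  obtain s L' R' where d: "?B \<in> carrier_mat r s" "?G \<in> carrier_mat s r" "L' \<in> carrier_mat s r" "R' \<in> carrier_mat r s"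
    "L' * ?B = 1\<^sub>m s" "?G * R' = 1\<^sub>m s" "Gs i * Bs i = ?B * ?G" .
  have up: "prod_up n Bs (Suc i) = ?U * ?B" and down: "prod_down n Gs (Suc i) = ?G * ?V" by simp_all
  have "L' * L * (?U * ?B) = 1\<^sub>m s"
    using IH(3,5) d(1,3,5) mult_mat_rewrite_prefix[OF IH(7), of ?B] by (simp add: mat_dim_simps)
  moreover have "?G * ?V * (R * R') = 1\<^sub>m s"
    using IH(4,6) d(2,4,6) mult_mat_rewrite_prefix[OF IH(8), of R'] by (simp add: mat_dim_simps)
  moreover have "A * (?U * ?B) = ?U * ?B * (?G * ?B)"
  proof -
    have "A * (?U * ?B) = A * ?U * ?B" using A IH(3) d(1) by (simp add: mat_dim_simps)
    also have "\<dots> = ?U * ?B * (?G * ?B)"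
      unfolding IH(9) d(7) using IH(3) d(1,2) by (simp add: mat_dim_simps)
    finally show ?thesis .
  qed
  moreover have "?G * ?V * A = ?G * ?B * (?G * ?V)"
  proof -
    have "?G * ?V * A = ?G * (?V * A)" using A IH(4) d(2) by (simp add: mat_dim_simps)
    also have "\<dots> = ?G * ?B * (?G * ?V)"
      unfolding IH(10) d(7) using IH(4) d(1,2) by (simp add: mat_dim_simps)
    finally show ?thesis .
  qed
  moreover have "?U * ?B * (?G * ?V) = A ^\<^sub>m Suc i"
  proof -
    have "?U * ?B * (?G * ?V) = ?U * (?B * ?G * ?V)"
      using IH(3,4) d(1,2) by (simp add: mat_dim_simps)
    \<comment> \<open>The inner product is folded back to \<open>G_i B_i\<close>, which passes
      through the lower product as a factor \<open>A\<close>.\<close>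
    also have "\<dots> = ?U * ?V * A"
      unfolding d(7)[symmetric] IH(10)[symmetric] using A IH(3,4) by (simp add: mat_dim_simps)
    finally show ?thesis using IH(11) by simp
  qed
  moreover have "?U * ?B \<in> carrier_mat n s" "?G * ?V \<in> carrier_mat s n"
    "L' * L \<in> carrier_mat s n" "R * R' \<in> carrier_mat n s"
    using IH(3-6) d(1-4) by simp_all
  ultimately show ?case unfolding up down using d(1,2) by (simp only: Suc_eq_plus1) blast
qed

theorem theorem3p1:
  fixes A B G P Q :: "complex mat" and Bs Gs :: "nat \<Rightarrow> complex mat" and n k :: nat
  assumes A: "A \<in> carrier_mat n n"
    and non_nilpotent: "\<not> nilpotent_mat A"
    and index: "matrix_index A = k" "k \<ge> 1"
    and decomp_1: "full_rank_decomposition A (Bs 1) (Gs 1)"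
    and decomp: "\<And>i. 1 \<le> i \<Longrightarrow> i \<le> k - 1 \<Longrightarrow>
      full_rank_decomposition (Gs i * Bs i) (Bs (i + 1)) (Gs (i + 1))"
    and B: "B = prod_up n Bs k"
    and G: "G = prod_down n Gs k"
    and P: "P = B * Gs k * Bs k"
    and Q: "Q = Gs k * Bs k * G"
  shows
    "(\<forall>\<^sub>F t in at 0. invertible_mat (P * mat_adjoint P + t \<cdot>\<^sub>m 1\<^sub>m (dim_row P))) \<and>
     mat_tendsto (\<lambda>t. B * mat_adjoint P * mat_inv (P * mat_adjoint P + t \<cdot>\<^sub>m 1\<^sub>m (dim_row P)))
       (core_EP_inverse A) (at 0) \<and>
     (\<forall>\<^sub>F t in at 0. invertible_mat (mat_adjoint P * P + t \<cdot>\<^sub>m 1\<^sub>m (dim_col P))) \<and>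
     mat_tendsto (\<lambda>t. B * mat_inv (mat_adjoint P * P + t \<cdot>\<^sub>m 1\<^sub>m (dim_col P)) * mat_adjoint P)
       (core_EP_inverse A) (at 0) \<and>
     (\<forall>\<^sub>F t in at 0. invertible_mat (mat_adjoint Q * Q + t \<cdot>\<^sub>m 1\<^sub>m (dim_col Q))) \<and>
     mat_tendsto (\<lambda>t. mat_inv (mat_adjoint Q * Q + t \<cdot>\<^sub>m 1\<^sub>m (dim_col Q)) * mat_adjoint Q * G)
       (dual_core_EP_inverse A) (at 0) \<and>
     (\<forall>\<^sub>F t in at 0. invertible_mat (Q * mat_adjoint Q + t \<cdot>\<^sub>m 1\<^sub>m (dim_row Q))) \<and>
     mat_tendsto (\<lambda>t. mat_adjoint Q * mat_inv (Q * mat_adjoint Q + t \<cdot>\<^sub>m 1\<^sub>m (dim_row Q)) * G)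
       (dual_core_EP_inverse A) (at 0)"
proof -
  obtain q r L R where c: "Bs k \<in> carrier_mat q r" "Gs k \<in> carrier_mat r q"
    "B \<in> carrier_mat n r" "G \<in> carrier_mat r n" "L \<in> carrier_mat r n" "R \<in> carrier_mat n r"
    "L * B = 1\<^sub>m r" "G * R = 1\<^sub>m r" "A * B = B * (Gs k * Bs k)" "G * A = Gs k * Bs k * G" "B * G = A ^\<^sub>m k"
    using full_rank_decomposition_chain[OF A decomp_1 decomp index(2) order_refl] unfolding B G by metis
  define M where "M = Gs k * Bs k"
  have M: "M \<in> carrier_mat r r" using c(1,2) by (simp add: M_def)
  \<comment> \<open>The value of the index enters here, to make the last core invertible.\<close>
  obtain U where U: "U \<in> carrier_mat n n" "A ^\<^sub>m k = A ^\<^sub>m Suc k * U"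
    using pow_matrix_index_factor[OF A] unfolding index(1) .
  \<comment> \<open>From \<open>B G = A^(k+1) U = B M G U\<close>, cancelling \<open>B\<close> by
    \<open>L\<close> and multiplying by \<open>R\<close> gives \<open>I = M G U R\<close>.\<close>
  define N where "N = G * U * R"
  have N: "N \<in> carrier_mat r r" using c(4,6) U(1) by (simp add: N_def)
  have "B * G = A * (B * G) * U"
    using U(2) unfolding pow_mat_Suc_left[OF A] c(11)[symmetric] .
  also have "\<dots> = A * B * (G * U)" using A c(3,4) U(1) by (simp add: mat_dim_simps)
  also have "\<dots> = B * (M * (G * U))"
    unfolding c(9) M_def[symmetric] using c(3,4) M U(1) by (simp add: mat_dim_simps)
  finally have BG: "B * G = B * (M * (G * U))" .
  have "1\<^sub>m r = L * (B * G) * R"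
    using mult_mat_rewrite_prefix[OF c(7), of "G * R"] c(3-8) by (simp add: mat_dim_simps)
  also have "\<dots> = L * B * (M * N)"
    unfolding BG N_def using c(3-6) M U(1) by (simp add: mat_dim_simps)
  finally have MN: "M * N = 1\<^sub>m r" using c(7) M N by (simp add: mat_dim_simps)
  \<comment> \<open>As \<open>M\<close> is square, its right inverse \<open>N\<close> is also a left
    inverse.\<close>
  interpret invertible_core A B G M N L R n r k
    using A c M N MN mat_mult_left_right_inverse[OF M N MN] by unfold_locales (auto simp: M_def)
  have P': "P = B * M" and Q': "Q = M * G"
    unfolding P Q M_def using c(1-4) by (simp_all add: mat_dim_simps)
  have dims: "dim_row P = n" "dim_col P = r" "dim_row Q = r" "dim_col Q = n"
    unfolding P' Q' using c(3,4) M by auto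
  show ?thesis
    unfolding dims using core_EP_inverse_limits[OF P'] dual_core_EP_inverse_limits[OF Q'] by blast
qed

end
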